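(* Let $k\ge 1$ be an integer and $c>0$. There is a constant $C$ (depending on $k$ and $c$) such that every $n$-vertex circle $k$-gon graph $G$ with $\alpha(G)\ge cn$ satisfies $h(G)\le C\frac{n\log\log n}{\log n}$.
   Context: A circle $k$-gon is the region of a disk bounded by a circle lying between $k$ or fewer non-crossing chords of the circle, with no chord connecting the arcs between two other chords; its sides are chords or arcs of the circle. A circle $k$-gon graph is the intersection graph of a finite family of circle $k$-gons in a common circle. $\alpha(G)$ is the independence number. A hitting set of $G$ is a set $T\subseteq V(G)$ meeting every maximum independent set; $h(G)$ is its minimum size. *)

theory Defs
  imports "HOL-Analysis.Analysis" "HOL-Library.Ramsey"
begin

text \<open>The plane is \<^typ>\<open>complex\<close>; the common circle is \<open>sphere z r\<close> with \<open>r > 0\<close>.\<close>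

definition circle_chord :: "complex \<Rightarrow> real \<Rightarrow> complex set \<Rightarrow> bool" where
  "circle_chord z r c \<longleftrightarrow>
     (\<exists>a b. a \<in> sphere z r \<and> b \<in> sphere z r \<and> a \<noteq> b \<and> c = closed_segment a b)"

text \<open>Non-crossing chords may share an endpoint on the circle, as consecutive sides of an
  inscribed polygon do.\<close>

definition noncrossing :: "complex \<Rightarrow> real \<Rightarrow> complex set \<Rightarrow> complex set \<Rightarrow> bool" where
  "noncrossing z r c d \<longleftrightarrow> c \<inter> d \<subseteq> sphere z r"

text \<open>For pairwise non-crossing chords, \<open>c\<close> connects the two arcs between \<open>d\<close> and \<open>e\<close>
  precisely when \<open>d\<close> and \<open>e\<close> lie on different sides of \<open>c\<close> in the disk. Endpoints
  of \<open>d\<close> and \<open>e\<close> count as belonging to the arcs, so that the diagonal of an inscribed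
  quadrilateral separates two opposite sides.\<close>

definition separates_chords ::
  "complex \<Rightarrow> real \<Rightarrow> complex set \<Rightarrow> complex set \<Rightarrow> complex set \<Rightarrow> bool" where
  "separates_chords z r c d e \<longleftrightarrow>
     (\<exists>x \<in> d - c. \<exists>y \<in> e - c. \<not> connected_component (cball z r - c) x y)"

text \<open>The region lying between the chords in \<open>\<C>\<close> is the (closed) piece of the disk cut along
  the chords that has every chord of \<open>\<C>\<close> on its boundary. It is unique if \<open>\<C>\<close> has at least
  two chords; a single chord bounds two regions, either of which is allowed; and for no chords it
  is the whole disk.\<close>

definition circle_kgon :: "nat \<Rightarrow> complex \<Rightarrow> real \<Rightarrow> complex set \<Rightarrow> bool" where
  "circle_kgon k z r P \<longleftrightarrow>
     (\<exists>\<C>. finite \<C> \<and> card \<C> \<le> k \<and>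
        (\<forall>c\<in>\<C>. circle_chord z r c) \<and>
        (\<forall>c\<in>\<C>. \<forall>d\<in>\<C>. c \<noteq> d \<longrightarrow> noncrossing z r c d) \<and>
        (\<forall>c\<in>\<C>. \<forall>d\<in>\<C>. \<forall>e\<in>\<C>. c \<noteq> d \<and> c \<noteq> e \<and> d \<noteq> e \<longrightarrow> \<not> separates_chords z r c d e) \<and>
        (\<exists>U \<in> components (cball z r - \<Union>\<C>). (\<forall>c\<in>\<C>. c \<subseteq> closure U) \<and> P = closure U))"

text \<open>Graphs are given by a vertex set and a set of two-element edges, as for \<^const>\<open>indep\<close>.
  The family of polygons is indexed by the vertices and need not be injective.\<close>

definition circle_kgon_graph :: "nat \<Rightarrow> 'a set \<Rightarrow> 'a set set \<Rightarrow> bool" where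
  "circle_kgon_graph k V E \<longleftrightarrow>
     finite V \<and>
     (\<exists>z r P. r > 0 \<and> (\<forall>v\<in>V. circle_kgon k z r (P v)) \<and>
        E = {{u, v} |u v. u \<in> V \<and> v \<in> V \<and> u \<noteq> v \<and> P u \<inter> P v \<noteq> {}})"

definition independence_number :: "'a set \<Rightarrow> 'a set set \<Rightarrow> nat" where
  "independence_number V E = Max {card S |S. S \<subseteq> V \<and> indep S E}"

definition maximum_indep :: "'a set \<Rightarrow> 'a set set \<Rightarrow> 'a set \<Rightarrow> bool" where
  "maximum_indep V E S \<longleftrightarrow> S \<subseteq> V \<and> indep S E \<and> card S = independence_number V E"

definition hitting_set :: "'a set \<Rightarrow> 'a set set \<Rightarrow> 'a set \<Rightarrow> bool" where
  "hitting_set V E T \<longleftrightarrow> T \<subseteq> V \<and> (\<forall>S. maximum_indep V E S \<longrightarrow> T \<inter> S \<noteq> {})"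

text \<open>Only meaningful for finite nonempty \<open>V\<close>, in which case \<open>V\<close> itself is a hitting set.\<close>

definition hitting_number :: "'a set \<Rightarrow> 'a set set \<Rightarrow> nat" where
  "hitting_number V E = Min {card T |T. hitting_set V E T}"

end

theory Submission
  imports Defs "HOL-Real_Asymp.Real_Asymp"
begin

text \<open>
  A circle polygon is the convex hull of its trace on the circle (Krein--Milman), so cutting the
  circle open turns every polygon into a union of few subsets of \<open>[0, 2\<pi>)\<close>, and two
  polygons are disjoint iff one of the traces avoids the hull of the other.

  Cut \<open>[0, 2\<pi>)\<close> into \<open>m = O(q)\<close> blocks such that at most \<open>n/q\<close> polygons have a
  trace that changes inside any given block, where \<open>q\<close> is about \<open>ln n\<close>. If some block
  contains the traces of two disjoint polygons, then the polygons changing inside that block hit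
  every maximum independent set \<open>S\<close>: otherwise at most one member of \<open>S\<close> meets the block, and
  exchanging it for the two disjoint polygons enlarges \<open>S\<close>.

  Otherwise group the members of \<open>S\<close> by the first and the last block they meet. In each group the
  members are nested, and some group is large and forms a positive fraction of all polygons with
  the same first and last block. Let \<open>u\<close> and \<open>v\<close> be its outermost and innermost members.
  The polygons of that type nested between them are partially ordered, and \<open>S\<close> must contain a
  chain among them that is at most two short of the height, so \<open>S\<close> meets all but two of the
  Mirsky levels, most of which have bounded size. There are only polynomially many choices of
  \<open>(u, v)\<close> and of the missed levels, so one colour class of a random \<open>q\<close>-colouring contains, for
  each choice, a whole level that is not missed.
\<close>

section \<open>Circle polygons as convex hulls of their traces\<close>

lemma complex_parallel:
  assumes "w \<noteq> 0" "Re w * Im y = Im w * Re y"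
  obtains t where "y = t *\<^sub>R w"
proof (cases "Re w = 0")
  case True
  then have "Im w \<noteq> 0" using assms(1) by (auto simp: complex_eq_iff)
  with True assms(2) show ?thesis
    by (intro that[of "Im y / Im w"]) (auto simp: complex_eq_iff)
next
  case False
  with assms(2) show ?thesis
    by (intro that[of "Re y / Re w"]) (auto simp: complex_eq_iff field_simps)
qed

text \<open>On the supporting line the squared distance to the centre is
  \<open>r^2 - t * (1 - t) * |a - b|^2\<close>, so a point of the line lies in the disk only for
  parameters \<open>t\<close> in \<open>[0, 1]\<close>, that is, on the chord. The last conclusion
  prepares the exclusion of extreme points inside the disk.\<close>

lemma circle_chord_line:
  assumes "circle_chord z r c" "r > 0"
  obtains n g where "n \<noteq> 0" "\<And>x. x \<in> c \<Longrightarrow> n \<bullet> x = g"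
    "\<And>x. x \<in> cball z r \<Longrightarrow> n \<bullet> x = g \<Longrightarrow> x \<in> c"
    "\<And>x. x \<in> c \<Longrightarrow> x \<notin> sphere z r \<Longrightarrow> \<exists>a\<in>c. \<exists>b\<in>c. x \<in> open_segment a b"
proof -
  obtain a b where ab: "norm (a - z) = r" "norm (b - z) = r" "a \<noteq> b" "c = closed_segment a b"
    using assms(1) unfolding circle_chord_def by (auto simp: dist_norm norm_minus_commute)
  \<comment> \<open>Multiplication by \<open>\<i>\<close> turns the direction of the chord by a
    right angle into a normal vector.\<close>
  define n where "n = \<i> * (b - a)"
  have n0: "n \<noteq> 0" using ab by (auto simp: n_def)
  have nba: "n \<bullet> (b - a) = 0" by (simp add: n_def inner_complex_def algebra_simps)
  have on: "n \<bullet> x = n \<bullet> a" if "x \<in> c" for x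
  proof -
    obtain u where "x = (1 - u) *\<^sub>R a + u *\<^sub>R b" using \<open>x \<in> c\<close> unfolding ab(4) in_segment by blast
    then have "x = a + u *\<^sub>R (b - a)" by (simp add: algebra_simps)
    then show ?thesis using nba by (simp add: inner_add_right)
  qed
  have in_c: "x \<in> c" if "x \<in> cball z r" "n \<bullet> x = n \<bullet> a" for x
  proof -
    define w where "w = b - a"
    have w0: "w \<noteq> 0" using ab by (simp add: w_def)
    have par: "Re w * Im (x - a) = Im w * Re (x - a)"
      using that(2) by (simp add: n_def inner_complex_def w_def algebra_simps)
    obtain t where "x - a = t *\<^sub>R w" using complex_parallel[OF _ par] w0 by auto
    then have x: "x = (1 - t) *\<^sub>R a + t *\<^sub>R b" by (simp add: w_def algebra_simps)
    define p q where "p = a - z" and "q = b - z"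
    have xz: "x - z = (1 - t) *\<^sub>R p + t *\<^sub>R q" by (simp add: x p_def q_def algebra_simps)
    have "(x - z) \<bullet> (x - z) = (1 - t) * (p \<bullet> p) + t * (q \<bullet> q) - t * (1 - t) * ((p - q) \<bullet> (p - q))"
      unfolding xz by (simp add: inner_simps inner_commute algebra_simps)
    moreover have "p \<bullet> p = r\<^sup>2" "q \<bullet> q = r\<^sup>2" using ab by (simp_all add: p_def q_def dot_square_norm)
    moreover have "(x - z) \<bullet> (x - z) \<le> r\<^sup>2"
      using that(1) by (simp add: dist_norm norm_minus_commute dot_square_norm power_mono)
    ultimately have "t * (1 - t) * ((p - q) \<bullet> (p - q)) \<ge> 0" by (simp add: algebra_simps)
    moreover have "(p - q) \<bullet> (p - q) > 0" using ab by (simp add: p_def q_def)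
    ultimately have "t * (1 - t) \<ge> 0" by (simp add: zero_le_mult_iff)
    then have "0 \<le> t" "t \<le> 1" by (auto simp: zero_le_mult_iff)
    then show ?thesis using x ab(4) by (auto simp: in_segment)
  qed
  have "\<exists>a\<in>c. \<exists>b\<in>c. x \<in> open_segment a b" if "x \<in> c" "x \<notin> sphere z r" for x
    using that ab by (auto simp: open_segment_def dist_norm norm_minus_commute)
  with n0 on in_c show ?thesis using that by blast
qed

lemma connected_halfplane:
  fixes U :: "'b::real_inner set"
  assumes "connected U" "\<And>x. x \<in> U \<Longrightarrow> n \<bullet> x \<noteq> g"
  shows "(\<forall>x\<in>U. n \<bullet> x < g) \<or> (\<forall>x\<in>U. n \<bullet> x > g)"
proof (rule ccontr)
  assume "\<not> ?thesis"
  then obtain x y where "x \<in> U" "y \<in> U" "n \<bullet> x \<le> g" "g \<le> n \<bullet> y" by force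
  moreover have "connected ((\<lambda>x. n \<bullet> x) ` U)"
    by (intro connected_continuous_image continuous_intros assms)
  ultimately have "g \<in> (\<lambda>x. n \<bullet> x) ` U"
    by (meson connected_contains_Icc atLeastAtMost_iff image_eqI subsetD)
  with assms(2) show False by auto
qed

text \<open>The component \<open>U\<close> lies strictly on one side of each chord. The disk cut by
  these open half-planes is convex, hence connected, and misses all chords, so it equals
  \<open>U\<close>; its closure is the cut by the closed half-planes. A point off the circle is
  interior or strictly inside a chord, so extreme points lie on the circle and Krein--Milman gives
  the hull formula.\<close>

lemma circle_kgon_halfplanes:
  assumes "circle_kgon k z r P" "r > 0"
  obtains \<C> :: "complex set set" and n :: "complex set \<Rightarrow> complex" and g :: "complex set \<Rightarrow> real"
  where "finite \<C>" "card \<C> \<le> k" "\<forall>c\<in>\<C>. n c \<noteq> 0"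
    "P = {x \<in> cball z r. \<forall>c\<in>\<C>. n c \<bullet> x \<le> g c}"
    "P \<noteq> {}" "P = convex hull (P \<inter> sphere z r)"
proof -
  obtain \<C> U where C: "finite \<C>" "card \<C> \<le> k" "\<forall>c\<in>\<C>. circle_chord z r c"
    and U: "U \<in> components (cball z r - \<Union>\<C>)" "\<forall>c\<in>\<C>. c \<subseteq> closure U" "P = closure U"
    using assms(1) unfolding circle_kgon_def by blast
  have Usub: "U \<subseteq> cball z r - \<Union>\<C>" and Uc: "connected U" and Une: "U \<noteq> {}"
    using U(1) in_components_subset in_components_connected in_components_nonempty by blast+
  \<comment> \<open>\<open>Q\<close> bundles what is needed of a line through the chord, oriented so
    that \<open>U\<close> is on its lower side; normals and offsets for all chords can then be
    chosen at once.\<close>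
  define Q where "Q c n g \<longleftrightarrow> n \<noteq> 0 \<and> (\<forall>x\<in>c. n \<bullet> x = g) \<and> (\<forall>x\<in>cball z r. n \<bullet> x = g \<longrightarrow> x \<in> c) \<and>
     (\<forall>x\<in>c. x \<notin> sphere z r \<longrightarrow> (\<exists>a\<in>c. \<exists>b\<in>c. x \<in> open_segment a b)) \<and> (\<forall>x\<in>U. n \<bullet> x < g)"
    for c n g
  have "\<exists>n g. Q c n g" if c: "c \<in> \<C>" for c
  proof -
    from C(3) c have ch: "circle_chord z r c" by blast
    obtain n g where ng: "n \<noteq> 0" "\<And>x. x \<in> c \<Longrightarrow> n \<bullet> x = g"
      "\<And>x. x \<in> cball z r \<Longrightarrow> n \<bullet> x = g \<Longrightarrow> x \<in> c"
      "\<And>x. x \<in> c \<Longrightarrow> x \<notin> sphere z r \<Longrightarrow> \<exists>a\<in>c. \<exists>b\<in>c. x \<in> open_segment a b"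
      using circle_chord_line[OF ch assms(2)] by metis
    have "n \<bullet> x \<noteq> g" if "x \<in> U" for x using Usub that ng(3) c by blast
    from connected_halfplane[OF Uc this] show ?thesis
    proof
      assume "\<forall>x\<in>U. n \<bullet> x < g"
      with ng have "Q c n g" unfolding Q_def by blast
      then show ?thesis by blast
    next
      assume gt: "\<forall>x\<in>U. n \<bullet> x > g"
      have "Q c (- n) (- g)" unfolding Q_def inner_minus_left neg_equal_iff_equal neg_less_iff_less
        using ng gt neg_equal_0_iff_equal by blast
      then show ?thesis by blast
    qed
  qed
  then obtain n g where "\<And>c. c \<in> \<C> \<Longrightarrow> Q c (n c) (g c)" by metis
  then have ng: "\<And>c. c \<in> \<C> \<Longrightarrow> n c \<noteq> 0" "\<And>c x. c \<in> \<C> \<Longrightarrow> x \<in> c \<Longrightarrow> n c \<bullet> x = g c"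
    "\<And>c x. c \<in> \<C> \<Longrightarrow> x \<in> cball z r \<Longrightarrow> n c \<bullet> x = g c \<Longrightarrow> x \<in> c"
    "\<And>c x. c \<in> \<C> \<Longrightarrow> x \<in> c \<Longrightarrow> x \<notin> sphere z r \<Longrightarrow> \<exists>a\<in>c. \<exists>b\<in>c. x \<in> open_segment a b"
    "\<And>c x. c \<in> \<C> \<Longrightarrow> x \<in> U \<Longrightarrow> n c \<bullet> x < g c"
    unfolding Q_def by blast+
  define K where "K = cball z r \<inter> (\<Inter>c\<in>\<C>. {x. n c \<bullet> x < g c})"
  define H where "H = cball z r \<inter> (\<Inter>c\<in>\<C>. {x. n c \<bullet> x \<le> g c})"
  have Kconv: "convex K" unfolding K_def
    by (intro convex_Int convex_INT convex_halfspace_lt convex_cball)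
  have Hconv: "convex H" unfolding H_def
    by (intro convex_Int convex_INT convex_halfspace_le convex_cball)
  have Hcl: "closed H" unfolding H_def
    by (intro closed_Int closed_INT ballI closed_halfspace_le closed_cball)
  have UK: "U \<subseteq> K" using Usub ng(5) by (auto simp: K_def)
  have "K \<subseteq> cball z r - \<Union>\<C>" using ng(2) by (fastforce simp: K_def)
  then have "K = U"
    using components_maximal[OF U(1) convex_connected[OF Kconv]] UK Une by blast
  obtain u where u: "u \<in> U" using Une by blast
  have "H \<subseteq> closure K"
  proof
    fix x assume x: "x \<in> H"
    \<comment> \<open>Moving from \<open>x\<close> slightly towards a point \<open>u\<close> of
      \<open>U\<close> makes every weak half-plane inequality strict, so \<open>x\<close> is a limit
      of points of \<open>K\<close>.\<close>
    define y where "y = (\<lambda>e::real. (1 - e) *\<^sub>R x + e *\<^sub>R u)"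
    have yK: "y e \<in> K" if "0 < e" "e < 1" for e
    proof -
      have "y e \<in> cball z r" unfolding y_def
        using x u Usub that by (intro convexD[OF convex_cball]) (auto simp: H_def)
      moreover have "n c \<bullet> y e < g c" if c: "c \<in> \<C>" for c
      proof -
        have "(1 - e) * (n c \<bullet> x) \<le> (1 - e) * g c"
          using x c \<open>e < 1\<close> by (intro mult_left_mono) (auto simp: H_def)
        moreover have "e * (n c \<bullet> u) < e * g c" using ng(5)[OF c u] \<open>0 < e\<close> by simp
        ultimately show ?thesis by (simp add: y_def inner_simps algebra_simps)
      qed
      ultimately show ?thesis by (simp add: K_def)
    qed
    have "(y \<longlongrightarrow> (1 - 0) *\<^sub>R x + 0 *\<^sub>R u) (at_right 0)" unfolding y_def
      by (intro tendsto_intros)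
    then have "(y \<longlongrightarrow> x) (at_right 0)" by simp
    moreover have "eventually (\<lambda>e. y e \<in> closure K) (at_right 0)"
      using eventually_at_right_real[OF zero_less_one]
      by eventually_elim (use yK closure_subset in auto)
    ultimately show "x \<in> closure K"
      using Lim_in_closed_set[OF closed_closure _ trivial_limit_at_right_real] by blast
  qed
  moreover have "closure K \<subseteq> H"
    using Hcl by (intro closure_minimal) (auto simp: K_def H_def less_imp_le)
  ultimately have PH: "P = H" using U(3) \<open>K = U\<close> by auto
  have "compact P" using PH Hcl by (auto simp: H_def compact_eq_bounded_closed bounded_Int)
  have "x \<in> sphere z r" if ext: "x extreme_point_of P" for x
  proof (rule ccontr)
    assume nos: "x \<notin> sphere z r"
    have xP: "x \<in> P" and noseg: "\<And>a b. a \<in> P \<Longrightarrow> b \<in> P \<Longrightarrow> x \<notin> open_segment a b"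
      using ext by (auto simp: extreme_point_of_def)
    show False
    proof (cases "\<exists>c\<in>\<C>. x \<in> c")
      case True
      then obtain c where "c \<in> \<C>" "x \<in> c" by blast
      \<comment> \<open>Chords are contained in \<open>closure U = P\<close> by definition, so
        \<open>x\<close> would be strictly inside a segment of \<open>P\<close>.\<close>
      then obtain a b where "a \<in> c" "b \<in> c" "x \<in> open_segment a b" using ng(4) nos by blast
      with noseg U(2,3) \<open>c \<in> \<C>\<close> show False by blast
    next
      case False
      have "x \<in> ball z r \<inter> (\<Inter>c\<in>\<C>. {x. n c \<bullet> x < g c})"
        using xP nos False ng(3) by (force simp: PH H_def order_less_le)
      moreover have "open (ball z r \<inter> (\<Inter>c\<in>\<C>. {x. n c \<bullet> x < g c}))"
        using C(1) by (intro open_Int open_INT ballI open_halfspace_lt open_ball)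
      moreover have "ball z r \<inter> (\<Inter>c\<in>\<C>. {x. n c \<bullet> x < g c}) \<subseteq> P"
        by (auto simp: PH H_def less_imp_le)
      ultimately have "x \<in> interior P" by (meson interiorI)
      with ext show False using extreme_point_not_in_interior by blast
    qed
  qed
  then have "{x. x extreme_point_of P} \<subseteq> P \<inter> sphere z r" by (auto simp: extreme_point_of_def)
  moreover have "P = convex hull {x. x extreme_point_of P}"
    using Krein_Milman_Minkowski \<open>compact P\<close> Hconv PH by blast
  ultimately have "P \<subseteq> convex hull (P \<inter> sphere z r)" using hull_mono by metis
  moreover have "convex hull (P \<inter> sphere z r) \<subseteq> P" using Hconv PH by (simp add: subset_hull)
  ultimately have "P = convex hull (P \<inter> sphere z r)" by blast
  moreover have "P \<noteq> {}" using U(3) Une by simp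
  moreover have "P = {x \<in> cball z r. \<forall>c\<in>\<C>. n c \<bullet> x \<le> g c}" using PH by (auto simp: H_def)
  ultimately show ?thesis using that C ng(1) by blast
qed

section \<open>Traces on the cut circle and disjointness of polygons\<close>

text \<open>The hull is the order-convex hull, from the first to the last point. It is expressed
  through pairs of points because a trace may be infinite and have no extreme elements.\<close>

definition avoids_hull :: "'b::linorder set \<Rightarrow> 'b set \<Rightarrow> bool" where
  "avoids_hull Q P \<longleftrightarrow> (\<forall>x\<in>P. \<forall>x'\<in>P. \<forall>y\<in>Q. \<not> (x \<le> y \<and> y \<le> x'))"

text \<open>The circle is cut open at angle 0; the half-open range gives each of its points exactly
  one angle.\<close>

definition angles :: "complex \<Rightarrow> real \<Rightarrow> complex set \<Rightarrow> real set" where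
  "angles z r P = {\<theta> \<in> {0..<2 * pi}. z + r *\<^sub>R cis \<theta> \<in> P}"

lemma sphere_cis:
  assumes "x \<in> sphere z r"
  obtains \<theta> where "\<theta> \<in> {0..<2 * pi}" "x = z + r *\<^sub>R cis \<theta>"
proof -
  have "x - z = r *\<^sub>R cis (Arg2pi (x - z))"
    using assms Arg2pi_eq[of "x - z"] by (simp add: dist_norm norm_minus_commute cis_conv_exp scaleR_conv_of_real)
  then show ?thesis
    using Arg2pi_ge_0[of "x - z"] Arg2pi_lt_2pi[of "x - z"]
    by (intro that[of "Arg2pi (x - z)"]) (auto simp: algebra_simps)
qed

lemma kgon_nonempty:
  assumes "circle_kgon k z r P" "r > 0"
  shows "P \<noteq> {}"
  by (rule circle_kgon_halfplanes[OF assms])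

lemma kgon_eq_hull:
  assumes "circle_kgon k z r P" "r > 0"
  shows "P = convex hull (P \<inter> sphere z r)"
  by (rule circle_kgon_halfplanes[OF assms])

lemma kgon_compact_convex:
  assumes "circle_kgon k z r P" "r > 0"
  shows "compact P" "convex P"
proof -
  obtain \<C> :: "complex set set" and n :: "complex set \<Rightarrow> complex" and g :: "complex set \<Rightarrow> real"
    where C: "finite \<C>" "card \<C> \<le> k" "\<forall>c\<in>\<C>. n c \<noteq> 0"
    "P = {x \<in> cball z r. \<forall>c\<in>\<C>. n c \<bullet> x \<le> g c}" "P \<noteq> {}" "P = convex hull (P \<inter> sphere z r)"
    by (rule circle_kgon_halfplanes[OF assms]) (rule that)
  have eq: "P = cball z r \<inter> (\<Inter>c\<in>\<C>. {x. n c \<bullet> x \<le> g c})" unfolding C(4) by auto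
  show "compact P" unfolding eq
    by (intro compact_Int_closed compact_cball closed_INT ballI closed_halfspace_le)
  show "convex P" unfolding eq
    by (intro convex_Int convex_INT convex_halfspace_le convex_cball)
qed

text \<open>A line meets a circle at most twice. Subtracting two of the equations and cancelling the
  sine of the half-difference shows that \<open>(A, B)\<close> is parallel to the unit vector at the
  mean of the two angles. Two such means, \<open>s\<close> and \<open>t\<close>, then satisfy
  \<open>sin (s - t) = 0\<close>, although \<open>s - t = (y - w) / 2\<close> is nonzero and lies
  strictly between \<open>-pi\<close> and \<open>pi\<close>.\<close>

lemma three_zeros_cos_sin:
  fixes A B \<gamma> :: real
  assumes "A \<noteq> 0 \<or> B \<noteq> 0" "A * cos x + B * sin x = \<gamma>" "A * cos y + B * sin y = \<gamma>"
    "A * cos w + B * sin w = \<gamma>" "x \<in> {0..<2 * pi}" "y \<in> {0..<2 * pi}" "w \<in> {0..<2 * pi}"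
  shows "x = y \<or> x = w \<or> y = w"
proof (rule ccontr)
  assume neq: "\<not> ?thesis"
  have half: "sin ((u - v) / 2) \<noteq> 0" if "u \<noteq> v" "u \<in> {0..<2 * pi}" "v \<in> {0..<2 * pi}" for u v :: real
  proof -
    have "u < 2 * pi" "v < 2 * pi" "0 \<le> u" "0 \<le> v" using that by auto
    then have "(u - v) / 2 < pi" "- ((u - v) / 2) < pi" by (simp_all add: field_simps)
    moreover from this(2) have "- pi < (u - v) / 2" by linarith
    ultimately show ?thesis using sin_eq_0_pi[of "(u - v) / 2"] that(1) by auto
  qed
  have mid: "B * cos ((u + v) / 2) = A * sin ((u + v) / 2)"
    if "u \<noteq> v" "u \<in> {0..<2 * pi}" "v \<in> {0..<2 * pi}"
      "A * cos u + B * sin u = \<gamma>" "A * cos v + B * sin v = \<gamma>" for u v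
  proof -
    have "A * (cos u - cos v) + B * (sin u - sin v) = 0" using that by (simp add: algebra_simps)
    also have "cos u - cos v = 2 * sin ((u + v) / 2) * sin ((v - u) / 2)" by (rule cos_diff_cos)
    also have "sin ((v - u) / 2) = - sin ((u - v) / 2)"
      by (metis minus_diff_eq minus_divide_left sin_minus)
    also have "sin u - sin v = 2 * sin ((u - v) / 2) * cos ((u + v) / 2)" by (rule sin_diff_sin)
    finally have "2 * sin ((u - v) / 2) * (B * cos ((u + v) / 2) - A * sin ((u + v) / 2)) = 0"
      by (simp add: algebra_simps)
    with half that show ?thesis by auto
  qed
  define s t where "s = (x + y) / 2" and "t = (x + w) / 2"
  have st: "B * cos s = A * sin s" "B * cos t = A * sin t"
    unfolding s_def t_def using neq assms by (auto intro!: mid)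
  have "A * (sin s * cos t - cos s * sin t) = cos t * (A * sin s) - cos s * (A * sin t)"
    by (simp add: algebra_simps)
  also have "\<dots> = 0" unfolding st[symmetric] by simp
  finally have A: "A * (sin s * cos t - cos s * sin t) = 0" .
  have "B * (sin s * cos t - cos s * sin t) = sin s * (B * cos t) - sin t * (B * cos s)"
    by (simp add: algebra_simps)
  also have "\<dots> = 0" unfolding st by simp
  finally have "B * (sin s * cos t - cos s * sin t) = 0" .
  with A have "sin (s - t) = 0" using assms(1) by (auto simp: sin_diff)
  moreover have "s - t = (y - w) / 2" by (simp add: s_def t_def field_simps)
  ultimately show False using half[of y w] neq assms by auto
qed

lemma inner_circle_point:
  "n \<bullet> (z + r *\<^sub>R cis \<theta>) = n \<bullet> z + (r * Re n * cos \<theta> + r * Im n * sin \<theta>)"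
  by (simp add: inner_complex_def algebra_simps)

lemma three_zeros_circle:
  assumes "n \<noteq> 0" "r > 0" "n \<bullet> (z + r *\<^sub>R cis x) = g" "n \<bullet> (z + r *\<^sub>R cis y) = g"
    "n \<bullet> (z + r *\<^sub>R cis w) = g" "x \<in> {0..<2 * pi}" "y \<in> {0..<2 * pi}" "w \<in> {0..<2 * pi}"
  shows "x = y \<or> x = w \<or> y = w"
proof (rule three_zeros_cos_sin)
  show "r * Re n \<noteq> 0 \<or> r * Im n \<noteq> 0" using assms by (auto simp: complex_eq_iff)
  show "r * Re n * cos x + r * Im n * sin x = g - n \<bullet> z"
    "r * Re n * cos y + r * Im n * sin y = g - n \<bullet> z"
    "r * Re n * cos w + r * Im n * sin w = g - n \<bullet> z"
    using assms(3-5) unfolding inner_circle_point by auto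
qed (use assms in auto)

lemma card_le_2I:
  assumes "\<And>x y w. x \<in> S \<Longrightarrow> y \<in> S \<Longrightarrow> w \<in> S \<Longrightarrow> x = y \<or> x = w \<or> y = w"
  shows "finite S \<and> card S \<le> 2"
proof (cases "\<exists>x y. x \<in> S \<and> y \<in> S \<and> x \<noteq> y")
  case True
  then obtain x y where "x \<in> S" "y \<in> S" "x \<noteq> y" by blast
  then have "S \<subseteq> {x, y}" using assms by blast
  moreover have "card {x, y} \<le> 2" by (simp add: card_insert_if)
  ultimately show ?thesis by (meson card_mono finite.simps finite_subset order_trans)
next
  case False
  then have "S = {} \<or> (\<exists>x. S = {x})" by blast
  then show ?thesis by auto
qed

lemma circle_level_between:
  assumes "n \<bullet> (z + r *\<^sub>R cis x) \<le> g \<and> g \<le> n \<bullet> (z + r *\<^sub>R cis x') \<or>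
    n \<bullet> (z + r *\<^sub>R cis x') \<le> g \<and> g \<le> n \<bullet> (z + r *\<^sub>R cis x)" "x \<le> x'"
  shows "\<exists>y. x \<le> y \<and> y \<le> x' \<and> n \<bullet> (z + r *\<^sub>R cis y) = g"
proof -
  have "continuous_on {x..x'} (\<lambda>y. n \<bullet> (z + r *\<^sub>R cis y))" by (intro continuous_intros)
  then show ?thesis using assms IVT'[of "\<lambda>y. n \<bullet> (z + r *\<^sub>R cis y)" x g x']
      IVT2'[of "\<lambda>y. n \<bullet> (z + r *\<^sub>R cis y)" x' g x] by blast
qed

text \<open>Membership in the trace can change only where one of the boundary lines is crossed, and
  each line crosses the circle at most twice. The crossing may coincide with \<open>x\<close> or
  \<open>x'\<close>, hence the weak inequalities.\<close>

lemma angles_changes: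
  assumes "circle_kgon k z r P" "r > 0"
  obtains Y :: "real set" where "finite Y" "card Y \<le> 2 * k"
    "\<And>x x'. x \<in> {0..<2 * pi} \<Longrightarrow> x' \<in> {0..<2 * pi} \<Longrightarrow> x \<le> x' \<Longrightarrow>
      (x \<in> angles z r P) \<noteq> (x' \<in> angles z r P) \<Longrightarrow> \<exists>y\<in>Y. x \<le> y \<and> y \<le> x'"
proof -
  obtain \<C> :: "complex set set" and n :: "complex set \<Rightarrow> complex" and g :: "complex set \<Rightarrow> real"
  where C: "finite \<C>" "card \<C> \<le> k" "\<forall>c\<in>\<C>. n c \<noteq> 0"
    "P = {x \<in> cball z r. \<forall>c\<in>\<C>. n c \<bullet> x \<le> g c}" "P \<noteq> {}" "P = convex hull (P \<inter> sphere z r)"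
    by (rule circle_kgon_halfplanes[OF assms]) (rule that)
  define Z where "Z c = {\<theta> \<in> {0..<2 * pi}. n c \<bullet> (z + r *\<^sub>R cis \<theta>) = g c}" for c
  have Z: "finite (Z c)" "card (Z c) \<le> 2" if "c \<in> \<C>" for c
  proof -
    have "x = y \<or> x = w \<or> y = w" if "x \<in> Z c" "y \<in> Z c" "w \<in> Z c" for x y w
      using three_zeros_circle[of "n c" r z x "g c" y w] that C(3) \<open>c \<in> \<C>\<close> assms(2)
      by (simp add: Z_def)
    from card_le_2I[OF this] show "finite (Z c)" "card (Z c) \<le> 2" by blast+
  qed
  have tr: "x \<in> angles z r P \<longleftrightarrow> (\<forall>c\<in>\<C>. n c \<bullet> (z + r *\<^sub>R cis x) \<le> g c)"
    if "x \<in> {0..<2 * pi}" for x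
    using that assms(2) by (auto simp: angles_def C(4) dist_norm)
  have "\<exists>y\<in>\<Union>(Z ` \<C>). x \<le> y \<and> y \<le> x'"
    if x: "x \<in> {0..<2 * pi}" "x' \<in> {0..<2 * pi}" "x \<le> x'"
      "(x \<in> angles z r P) \<noteq> (x' \<in> angles z r P)" for x x'
  proof -
    let ?f = "\<lambda>c u. n c \<bullet> (z + r *\<^sub>R cis u)"
    obtain c where c: "c \<in> \<C>" "?f c x \<le> g c \<and> g c \<le> ?f c x' \<or> ?f c x' \<le> g c \<and> g c \<le> ?f c x"
    proof (cases "x \<in> angles z r P")
      case True
      with x(4) have "\<forall>c\<in>\<C>. ?f c x \<le> g c" "\<not> (\<forall>c\<in>\<C>. ?f c x' \<le> g c)"
        using tr[OF x(1)] tr[OF x(2)] by blast+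
      then show ?thesis using that by (meson nle_le)
    next
      case False
      with x(4) have "\<forall>c\<in>\<C>. ?f c x' \<le> g c" "\<not> (\<forall>c\<in>\<C>. ?f c x \<le> g c)"
        using tr[OF x(1)] tr[OF x(2)] by blast+
      then show ?thesis using that by (meson nle_le)
    qed
    then obtain y where "x \<le> y" "y \<le> x'" "n c \<bullet> (z + r *\<^sub>R cis y) = g c"
      using circle_level_between x(3) by blast
    with x c(1) show ?thesis by (intro bexI[of _ y]) (auto simp: Z_def)
  qed
  moreover have "finite (\<Union>(Z ` \<C>))" using C(1) Z by blast
  moreover have "card (\<Union>(Z ` \<C>)) \<le> 2 * k"
  proof -
    have "card (\<Union>(Z ` \<C>)) \<le> (\<Sum>c\<in>\<C>. card (Z c))" by (rule card_UN_le[OF C(1)])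
    also have "\<dots> \<le> card \<C> * 2" using Z by (metis sum_bounded_above of_nat_id)
    finally show ?thesis using C(2) by simp
  qed
  ultimately show ?thesis using that by blast
qed

lemma angles_nonempty:
  assumes "circle_kgon k z r P" "r > 0"
  shows "angles z r P \<noteq> {}"
proof -
  note kgon_nonempty[OF assms] kgon_eq_hull[OF assms]
  then have "P \<inter> sphere z r \<noteq> {}" using convex_hull_eq_empty by metis
  then obtain x where "x \<in> P" "x \<in> sphere z r" by blast
  moreover from this(2) obtain \<theta> where "\<theta> \<in> {0..<2 * pi}" "x = z + r *\<^sub>R cis \<theta>"
    using sphere_cis by blast
  ultimately have "\<theta> \<in> angles z r P" by (simp add: angles_def)
  then show ?thesis by blast
qed

text \<open>A common point is a convex combination of finitely many trace points of
  \<open>P\<close>. These lie on the arc from \<open>a\<close> to \<open>b\<close>, and the line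
  through the ends of that arc (the tangent if they coincide) separates it strictly from all trace
  points of \<open>Q\<close>, hence from the hull \<open>Q\<close>.\<close>

lemma kgon_disjointI:
  assumes P: "circle_kgon k z r P" and Q: "circle_kgon k z r Q" and r: "r > 0"
    and av: "avoids_hull (angles z r Q) (angles z r P)"
  shows "P \<inter> Q = {}"
proof (rule ccontr)
  assume "P \<inter> Q \<noteq> {}"
  then obtain x where x: "x \<in> P" "x \<in> Q" by blast
  have hull: "P = convex hull (P \<inter> sphere z r)" "Q = convex hull (Q \<inter> sphere z r)"
    using kgon_eq_hull P Q r by blast+
  have "x \<in> convex hull (P \<inter> sphere z r)" using x hull(1) by blast
  \<comment> \<open>A finite subset is taken so that the first and last angle exist; the full trace
    may approach \<open>2 * pi\<close> without a maximum.\<close>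
  then obtain F where F: "finite F" "F \<subseteq> P \<inter> sphere z r" "x \<in> convex hull F"
    unfolding convex_hull_caratheodory[of "P \<inter> sphere z r"] convex_hull_explicit by blast
  define \<Theta> where "\<Theta> = {\<theta> \<in> {0..<2 * pi}. z + r *\<^sub>R cis \<theta> \<in> F}"
  have cis_inj: "\<theta> = \<theta>'" if "\<theta> \<in> {0..<2 * pi}" "\<theta>' \<in> {0..<2 * pi}" "z + r *\<^sub>R cis \<theta> = z + r *\<^sub>R cis \<theta>'" for \<theta> \<theta>'
  proof -
    have "cis \<theta> = cis \<theta>'" using that r by simp
    then show ?thesis using that(1,2) using Arg2pi_unique[of 1 \<theta> "cis \<theta>"] Arg2pi_unique[of 1 \<theta>' "cis \<theta>'"]
      by (simp add: cis_conv_exp)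
  qed
  have "finite \<Theta>"
    by (rule inj_on_finite[OF _ _ F(1), of "\<lambda>\<theta>. z + r *\<^sub>R cis \<theta>"])
       (auto simp: \<Theta>_def intro!: inj_onI cis_inj)
  have Fimg: "\<exists>\<theta>\<in>\<Theta>. y = z + r *\<^sub>R cis \<theta>" if "y \<in> F" for y
  proof -
    have "y \<in> sphere z r" using that F(2) by blast
    then obtain \<theta> where "\<theta> \<in> {0..<2 * pi}" "y = z + r *\<^sub>R cis \<theta>" using sphere_cis by blast
    with that show ?thesis unfolding \<Theta>_def by blast
  qed
  have "F \<noteq> {}" using F(3) by auto
  then have "\<Theta> \<noteq> {}" using Fimg by blast
  have \<Theta>P: "\<Theta> \<subseteq> angles z r P" using F(2) by (auto simp: \<Theta>_def angles_def)
  define a b where "a = Min \<Theta>" and "b = Max \<Theta>"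
  \<comment> \<open>Middle and half-width of the arc. On the circle the functional
    \<open>cis m\<close> depends only on the angular distance to \<open>m\<close>, which is at most
    \<open>d\<close> for \<open>F\<close> and larger for \<open>Q\<close>.\<close>
  define m d where "m = (a + b) / 2" and "d = (b - a) / 2"
  have ab: "a \<in> \<Theta>" "b \<in> \<Theta>" "\<And>\<theta>. \<theta> \<in> \<Theta> \<Longrightarrow> a \<le> \<theta> \<and> \<theta> \<le> b"
    using \<open>finite \<Theta>\<close> \<open>\<Theta> \<noteq> {}\<close> by (auto simp: a_def b_def)
  have rng: "0 \<le> a" "a \<le> b" "b < 2 * pi" using ab by (auto simp: \<Theta>_def)
  have n: "cis m \<bullet> (z + r *\<^sub>R cis \<theta>) = cis m \<bullet> z + r * cos (\<theta> - m)" for \<theta>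
    unfolding inner_circle_point cos_diff by (simp add: algebra_simps)
  have "F \<subseteq> {y. cis m \<bullet> y \<ge> cis m \<bullet> z + r * cos d}"
  proof
    fix y assume "y \<in> F"
    then obtain \<theta> where \<theta>: "\<theta> \<in> \<Theta>" "y = z + r *\<^sub>R cis \<theta>" using Fimg by blast
    then have "\<bar>\<theta> - m\<bar> \<le> d" using ab(3)[OF \<theta>(1)] by (auto simp: m_def d_def abs_if field_simps)
    moreover have "d \<le> pi" using rng by (simp add: d_def)
    ultimately have "cos d \<le> cos \<bar>\<theta> - m\<bar>" by (intro cos_monotone_0_pi_le) auto
    then show "y \<in> {y. cis m \<bullet> y \<ge> cis m \<bullet> z + r * cos d}" using r by (simp add: \<theta>(2) n)
  qed
  then have "convex hull F \<subseteq> {y. cis m \<bullet> y \<ge> cis m \<bullet> z + r * cos d}"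
    by (intro hull_minimal convex_halfspace_ge)
  moreover have "Q \<inter> sphere z r \<subseteq> {y. cis m \<bullet> y < cis m \<bullet> z + r * cos d}"
  proof
    fix y assume y: "y \<in> Q \<inter> sphere z r"
    then obtain \<theta> where \<theta>: "\<theta> \<in> {0..<2 * pi}" "y = z + r *\<^sub>R cis \<theta>" using sphere_cis[of y z r] by auto
    then have "\<theta> \<in> angles z r Q" using y by (auto simp: angles_def)
    moreover have "a \<in> angles z r P" "b \<in> angles z r P" using ab \<Theta>P by blast+
    ultimately have "\<not> (a \<le> \<theta> \<and> \<theta> \<le> b)" using av unfolding avoids_hull_def by blast
    then have "\<theta> < a \<or> b < \<theta>" by linarith
    then have lt: "d < \<bar>\<theta> - m\<bar>" "\<bar>\<theta> - m\<bar> < 2 * pi - d" "0 \<le> d"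
      using \<theta>(1) rng by (auto simp: m_def d_def abs_if field_simps)
    have "cos (\<theta> - m) < cos d"
    proof (cases "\<bar>\<theta> - m\<bar> \<le> pi")
      case True
      then have "cos \<bar>\<theta> - m\<bar> < cos d" using lt by (intro cos_monotone_0_pi) auto
      then show ?thesis by simp
    next
      case False
      \<comment> \<open>Beyond \<open>pi\<close> the cosine increases again; the reflected distance
        is back in \<open>[0, pi]\<close> and still exceeds \<open>d\<close>.\<close>
      then have "cos (2 * pi - \<bar>\<theta> - m\<bar>) < cos d" using lt by (intro cos_monotone_0_pi) auto
      then show ?thesis by (simp add: cos_diff)
    qed
    then show "y \<in> {y. cis m \<bullet> y < cis m \<bullet> z + r * cos d}" using r by (simp add: \<theta>(2) n)
  qed
  then have "convex hull (Q \<inter> sphere z r) \<subseteq> {y. cis m \<bullet> y < cis m \<bullet> z + r * cos d}"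
    by (intro hull_minimal convex_halfspace_lt)
  ultimately show False using F(3) x(2) hull(2) by fastforce
qed

text \<open>A separating line meets the circle at most twice, so its two sides cannot alternate over
  four points of the cut circle. If both hulls were hit, a pattern Q P Q together with a pattern P Q
  P would give such an alternation, starting at whichever of \<open>x\<close> and \<open>p\<close>
  comes first.\<close>

lemma kgon_avoids_hull:
  assumes P: "circle_kgon k z r P" and Q: "circle_kgon k z r Q" and r: "r > 0"
    and disj: "P \<inter> Q = {}"
  shows "avoids_hull (angles z r P) (angles z r Q) \<or> avoids_hull (angles z r Q) (angles z r P)"
proof (rule ccontr)
  assume nav: "\<not> ?thesis"
  note cc = kgon_compact_convex[OF P r] kgon_compact_convex[OF Q r] kgon_nonempty[OF P r] kgon_nonempty[OF Q r]
  obtain n g where ng: "\<And>x. x \<in> P \<Longrightarrow> n \<bullet> x < g" "\<And>x. x \<in> Q \<Longrightarrow> n \<bullet> x > g"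
    using separating_hyperplane_compact_closed[of P Q] cc disj compact_imp_closed by metis
  have n0: "n \<noteq> 0" using ng cc by fastforce
  define f where "f \<theta> = n \<bullet> (z + r *\<^sub>R cis \<theta>)" for \<theta>
  have fP: "f \<theta> < g" "\<theta> \<in> {0..<2 * pi}" if "\<theta> \<in> angles z r P" for \<theta>
    using that ng by (auto simp: f_def angles_def)
  have fQ: "f \<theta> > g" "\<theta> \<in> {0..<2 * pi}" if "\<theta> \<in> angles z r Q" for \<theta>
    using that ng by (auto simp: f_def angles_def)
  have zero: "\<exists>y. u < y \<and> y < v \<and> f y = g" if h: "f u < g \<and> g < f v \<or> f v < g \<and> g < f u" "u \<le> v" for u v
  proof -
    obtain y where "u \<le> y" "y \<le> v" "f y = g"
      using circle_level_between[of n z r u g v] h unfolding f_def by (meson less_imp_le)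
    with h show ?thesis by (metis less_irrefl order_less_le)
  qed
  \<comment> \<open>Each of the three sign changes yields a zero of \<open>f - g\<close> strictly
    between the points.\<close>
  have noalt: False if h: "u \<in> {0..<2 * pi}" "u < v" "v < w" "w < x" "x \<in> {0..<2 * pi}"
    "f u < g \<and> g < f v \<and> f w < g \<and> g < f x \<or> g < f u \<and> f v < g \<and> g < f w \<and> f x < g" for u v w x
  proof -
    obtain y1 y2 y3 where y: "u < y1" "y1 < v" "f y1 = g" "v < y2" "y2 < w" "f y2 = g" "w < y3" "y3 < x" "f y3 = g"
      using zero[of u v] zero[of v w] zero[of w x] h less_imp_le by blast
    have "y1 \<in> {0..<2 * pi}" "y2 \<in> {0..<2 * pi}" "y3 \<in> {0..<2 * pi}" using y h by auto
    with y show False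
      using three_zeros_circle[OF n0 r, of z y1 g y2 y3] by (simp add: f_def)
  qed
  obtain x x' y where x: "x \<in> angles z r Q" "x' \<in> angles z r Q" "y \<in> angles z r P" "x \<le> y" "y \<le> x'"
    using nav unfolding avoids_hull_def by blast
  obtain p p' e where p: "p \<in> angles z r P" "p' \<in> angles z r P" "e \<in> angles z r Q" "p \<le> e" "e \<le> p'"
    using nav unfolding avoids_hull_def by blast
  have neq: "\<theta> \<noteq> \<theta>'" if "\<theta> \<in> angles z r P" "\<theta>' \<in> angles z r Q" for \<theta> \<theta>'
    using fP(1)[OF that(1)] fQ(1)[OF that(2)] by auto
  have lt: "x < y" "y < x'" "p < e" "e < p'"
    using x(4,5) p(4,5) neq[OF x(3,1)] neq[OF x(3,2)] neq[OF p(1,3)] neq[OF p(2,3)]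
    by (simp_all add: order_less_le)
  note f = fQ[OF x(1)] fQ[OF x(2)] fP[OF x(3)] fP[OF p(1)] fP[OF p(2)] fQ[OF p(3)]
  consider "x < p" | "p < x" using neq[OF p(1) x(1)] by force
  then show False
  proof cases
    case 1
    show False
      by (rule noalt[OF _ 1 lt(3,4)]) (use f in simp_all)
  next
    case 2
    show False
      by (rule noalt[OF _ 2 lt(1,2)]) (use f in simp_all)
  qed
qed

section \<open>Heights and ranks of finite orders\<close>

definition chain_on :: "('a \<Rightarrow> 'a \<Rightarrow> bool) \<Rightarrow> 'a set \<Rightarrow> bool" where
  "chain_on R C \<longleftrightarrow> (\<forall>x\<in>C. \<forall>y\<in>C. x \<noteq> y \<longrightarrow> R x y \<or> R y x)"

definition height_on :: "('a \<Rightarrow> 'a \<Rightarrow> bool) \<Rightarrow> 'a set \<Rightarrow> nat" where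
  "height_on R W = Max (card ` {C. C \<subseteq> W \<and> chain_on R C})"

text \<open>The height of the strict down-set, so ranks start at 0; the fibres are the levels of
  Mirsky's theorem.\<close>

definition rank_on :: "('a \<Rightarrow> 'a \<Rightarrow> bool) \<Rightarrow> 'a set \<Rightarrow> 'a \<Rightarrow> nat" where
  "rank_on R W x = height_on R {y \<in> W. R y x}"

lemma card_le_height_on:
  assumes "finite W" "C \<subseteq> W" "chain_on R C"
  shows "card C \<le> height_on R W"
  unfolding height_on_def using assms by (intro Max_ge) auto

lemma height_on_attained:
  assumes "finite W"
  obtains C where "C \<subseteq> W" "chain_on R C" "card C = height_on R W"
proof -
  have "{} \<in> {C. C \<subseteq> W \<and> chain_on R C}" by (simp add: chain_on_def)
  then have "height_on R W \<in> card ` {C. C \<subseteq> W \<and> chain_on R C}"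
    unfolding height_on_def using assms by (intro Max_in) auto
  with that show ?thesis by auto
qed

lemma rank_on_chain:
  assumes "finite W" "transp_on W R" "irreflp_on W R" "x \<in> W"
  obtains C where "C \<subseteq> insert x {y \<in> W. R y x}" "chain_on R C" "card C = Suc (rank_on R W x)"
proof -
  obtain C where C: "C \<subseteq> {y \<in> W. R y x}" "chain_on R C" "card C = rank_on R W x"
    using assms(1) height_on_attained[of "{y \<in> W. R y x}" R] by (auto simp: rank_on_def)
  have "finite C" using C(1) assms(1) by (auto intro: finite_subset)
  moreover have "x \<notin> C" using C(1) assms(3,4) by (auto simp: irreflp_on_def)
  moreover have "chain_on R (insert x C)" using C by (auto simp: chain_on_def)
  ultimately show ?thesis using that[of "insert x C"] C by auto
qed

lemma rank_on_less_height_on: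
  assumes "finite W" "transp_on W R" "irreflp_on W R" "x \<in> W"
  shows "rank_on R W x < height_on R W"
proof -
  obtain C where C: "C \<subseteq> insert x {y \<in> W. R y x}" "chain_on R C" "card C = Suc (rank_on R W x)"
    using rank_on_chain[OF assms] by blast
  then have "card C \<le> height_on R W"
    using assms by (intro card_le_height_on) auto
  with C show ?thesis by simp
qed

lemma rank_on_strict_mono:
  assumes "finite W" "transp_on W R" "irreflp_on W R" "x \<in> W" "y \<in> W" "R x y"
  shows "rank_on R W x < rank_on R W y"
proof -
  obtain C where C: "C \<subseteq> insert x {y \<in> W. R y x}" "chain_on R C" "card C = Suc (rank_on R W x)"
    using rank_on_chain[OF assms(1-4)] by blast
  have "C \<subseteq> {z \<in> W. R z y}" using C(1) assms(2,4-6) by (auto dest: transp_onD)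
  then have "card C \<le> rank_on R W y"
    unfolding rank_on_def using assms(1) C by (intro card_le_height_on) auto
  with C show ?thesis by simp
qed

section \<open>Sparse sets containing a member of each family\<close>

text \<open>A random colouring treats the disjoint sets \<open>L i\<close> independently, and each
  becomes entirely \<open>j\<close>-coloured with probability at least \<open>1 / q ^ D\<close>. The
  induction splits off one set \<open>L i\<close> and passes to the smaller ground set, so
  \<open>V\<close> is arbitrary.\<close>

lemma card_colourings_avoiding:
  fixes L :: "'i \<Rightarrow> 'a set"
  assumes "finite J" "finite V" "q > 0" "disjoint_family_on L J" "j < q"
    "\<And>i. i \<in> J \<Longrightarrow> L i \<subseteq> V \<and> card (L i) \<le> D"
  shows "real (card {f \<in> V \<rightarrow>\<^sub>E {..<q}. \<forall>i\<in>J. \<exists>x\<in>L i. f x \<noteq> j})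
           \<le> real q ^ card V * (1 - 1 / real q ^ D) ^ card J"
  using assms
proof (induction J arbitrary: V rule: finite_induct)
  case empty
  then show ?case by (simp add: card_PiE)
next
  case (insert i J)
  define W where "W = V - L i"
  let ?A = "{f \<in> V \<rightarrow>\<^sub>E {..<q}. \<forall>i\<in>insert i J. \<exists>x\<in>L i. f x \<noteq> j}"
  let ?B = "(L i \<rightarrow>\<^sub>E {..<q}) - {restrict (\<lambda>_. j) (L i)}"
  let ?C = "{f \<in> W \<rightarrow>\<^sub>E {..<q}. \<forall>i\<in>J. \<exists>x\<in>L i. f x \<noteq> j}"
  have Li: "L i \<subseteq> V" "card (L i) \<le> D" using insert.prems by auto
  then have "finite (L i)" using insert.prems finite_subset by blast
  note Li = Li this
  have LW: "L i' \<subseteq> W" if "i' \<in> J" for i'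
    using insert.prems that insert.hyps unfolding W_def disjoint_family_on_def by fastforce
  have fin: "finite W" using insert.prems by (simp add: W_def)
  have dj: "disjoint_family_on L J" using insert.prems by (auto simp: disjoint_family_on_def)
  have "finite ?B" "finite ?C" using Li fin by (auto simp: finite_PiE)
  \<comment> \<open>A colouring is determined by its restrictions to \<open>L i\<close>, where it is
    not constantly \<open>j\<close>, and to \<open>W\<close>, where the induction hypothesis
    applies.\<close>
  have "card ?A \<le> card (?B \<times> ?C)"
  proof (rule card_inj_on_le)
    show "inj_on (\<lambda>f. (restrict f (L i), restrict f W)) ?A"
    proof (rule inj_onI)
      fix f f' assume "f \<in> ?A" "f' \<in> ?A" and
        eq: "(restrict f (L i), restrict f W) = (restrict f' (L i), restrict f' W)"
      then have ext: "f \<in> extensional V" "f' \<in> extensional V" by (auto simp: PiE_def)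
      show "f = f'"
      proof (rule extensionalityI[OF ext])
        fix x assume "x \<in> V"
        then have "x \<in> L i \<or> x \<in> W" by (auto simp: W_def)
        with eq show "f x = f' x" by (metis prod.inject restrict_apply')
      qed
    qed
    have "restrict f (L i) \<noteq> restrict (\<lambda>_. j) (L i)" if "\<exists>x\<in>L i. f x \<noteq> j" for f :: "'a \<Rightarrow> nat"
      using that by (metis restrict_apply')
    moreover have "\<exists>x\<in>L i'. restrict f W x \<noteq> j" if "i' \<in> J" "\<exists>x\<in>L i'. f x \<noteq> j" for f :: "'a \<Rightarrow> nat" and i'
      using LW[OF that(1)] that(2) by (metis restrict_apply' subsetD)
    ultimately show "(\<lambda>f. (restrict f (L i), restrict f W)) ` ?A \<subseteq> ?B \<times> ?C"
      using Li(1) by (auto simp: W_def PiE_iff subset_iff)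
    show "finite (?B \<times> ?C)" using \<open>finite ?B\<close> \<open>finite ?C\<close> by blast
  qed
  also have "\<dots> = card ?B * card ?C" by (rule card_cartesian_product)
  finally have "real (card ?A) \<le> real (card ?B * card ?C)" by (rule of_nat_mono)
  then have *: "real (card ?A) \<le> real (card ?B) * real (card ?C)" by (simp only: of_nat_mult)
  have "restrict (\<lambda>_. j) (L i) \<in> L i \<rightarrow>\<^sub>E {..<q}" using \<open>j < q\<close> by auto
  then have "card ?B = q ^ card (L i) - 1"
    using Li(3) by (simp add: card_PiE)
  then have "real (card ?B) = real q ^ card (L i) * (1 - 1 / real q ^ card (L i))"
    using \<open>q > 0\<close> by (simp add: of_nat_diff algebra_simps)
  also have "\<dots> \<le> real q ^ card (L i) * (1 - 1 / real q ^ D)"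
    using \<open>q > 0\<close> Li(2) by (intro mult_left_mono diff_left_mono divide_left_mono power_increasing) auto
  finally have B: "real (card ?B) \<le> real q ^ card (L i) * (1 - 1 / real q ^ D)" .
  have C: "real (card ?C) \<le> real q ^ card W * (1 - 1 / real q ^ D) ^ card J"
    using insert.IH[OF fin \<open>q > 0\<close> dj \<open>j < q\<close>] LW insert.prems by auto
  have q1: "0 \<le> 1 - 1 / real q ^ D" using \<open>q > 0\<close> by (simp add: field_simps)
  have "real (card ?A) \<le> (real q ^ card (L i) * (1 - 1 / real q ^ D)) *
       (real q ^ card W * (1 - 1 / real q ^ D) ^ card J)"
    using B C q1 by (intro order.trans[OF *] mult_mono) auto
  also have "\<dots> = real q ^ (card (L i) + card W) * (1 - 1 / real q ^ D) ^ card (insert i J)"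
    using insert.hyps by (simp add: power_add algebra_simps)
  also have "card (L i) + card W = card V"
    using Li \<open>finite V\<close> by (simp add: W_def card_Diff_subset card_mono)
  finally show ?case .
qed

text \<open>By a union bound over all pairs of a family \<open>w\<close> and a colour
  \<open>j\<close>, some \<open>q\<close>-colouring makes every colour class contain a whole member
  of every family. The smallest class has at most \<open>card V / q\<close> elements.\<close>

lemma exists_sparse_transversal:
  fixes L :: "'w \<Rightarrow> 'i \<Rightarrow> 'a set"
  assumes V: "finite V" and q: "q > 0" and fin: "finite \<Omega>"
    and J: "\<And>w. w \<in> \<Omega> \<Longrightarrow> finite (J w) \<and> M \<le> card (J w) \<and> disjoint_family_on (L w) (J w)"
    and L: "\<And>w i. w \<in> \<Omega> \<Longrightarrow> i \<in> J w \<Longrightarrow> L w i \<subseteq> V \<and> card (L w i) \<le> D"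
    and few: "real (card \<Omega>) * real q * (1 - 1 / real q ^ D) ^ M < 1"
  shows "\<exists>T\<subseteq>V. q * card T \<le> card V \<and> (\<forall>w\<in>\<Omega>. \<exists>i\<in>J w. L w i \<subseteq> T)"
proof -
  define bad where "bad = (\<lambda>(w, j). {f \<in> V \<rightarrow>\<^sub>E {..<q}. \<forall>i\<in>J w. \<exists>x\<in>L w i. f x \<noteq> j})"
  have finbad: "finite (bad p)" for p using V by (auto simp: bad_def finite_PiE split: prod.split)
  have qD: "0 \<le> 1 - 1 / real q ^ D" "1 - 1 / real q ^ D \<le> 1"
    using q by (simp_all add: field_simps)
  have "real (card (\<Union>p\<in>\<Omega> \<times> {..<q}. bad p)) \<le> (\<Sum>p\<in>\<Omega> \<times> {..<q}. real (card (bad p)))"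
    using card_UN_le[of "\<Omega> \<times> {..<q}" bad] fin by (metis finite_SigmaI finite_lessThan of_nat_le_iff of_nat_sum)
  also have "\<dots> \<le> (\<Sum>p\<in>\<Omega> \<times> {..<q}. real q ^ card V * (1 - 1 / real q ^ D) ^ M)"
  proof (rule sum_mono)
    fix p assume "p \<in> \<Omega> \<times> {..<q}"
    then obtain w j where p: "p = (w, j)" "w \<in> \<Omega>" "j < q" by auto
    have "real (card (bad p)) \<le> real q ^ card V * (1 - 1 / real q ^ D) ^ card (J w)"
      unfolding p(1) bad_def using J L p by (simp add: card_colourings_avoiding V q)
    also have "\<dots> \<le> real q ^ card V * (1 - 1 / real q ^ D) ^ M"
      using J[OF p(2)] qD by (intro mult_left_mono power_decreasing) auto
    finally show "real (card (bad p)) \<le> real q ^ card V * (1 - 1 / real q ^ D) ^ M" .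
  qed
  also have "\<dots> = real q ^ card V * (real (card \<Omega>) * real q * (1 - 1 / real q ^ D) ^ M)"
    by (simp add: card_cartesian_product)
  also have "\<dots> < real q ^ card V * 1" using few q by (intro mult_strict_left_mono) auto
  also have "\<dots> = real (card (V \<rightarrow>\<^sub>E {..<q}))" using V by (simp add: card_PiE)
  finally have "card (\<Union>p\<in>\<Omega> \<times> {..<q}. bad p) < card (V \<rightarrow>\<^sub>E {..<q})" by simp
  then have "\<not> (V \<rightarrow>\<^sub>E {..<q}) \<subseteq> (\<Union>p\<in>\<Omega> \<times> {..<q}. bad p)"
    using card_mono[of "\<Union>p\<in>\<Omega> \<times> {..<q}. bad p" "V \<rightarrow>\<^sub>E {..<q}"] fin finbad by force
  then obtain f where f: "f \<in> V \<rightarrow>\<^sub>E {..<q}" "f \<notin> (\<Union>p\<in>\<Omega> \<times> {..<q}. bad p)" by blast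
  define T where "T j = {x \<in> V. f x = j}" for j
  \<comment> \<open>Pigeonhole: the \<open>q\<close> colour classes partition
    \<open>V\<close>.\<close>
  have "\<exists>j<q. q * card (T j) \<le> card V"
  proof (rule ccontr)
    assume "\<not> ?thesis"
    then have "(\<Sum>j<q. card V) < (\<Sum>j<q. q * card (T j))"
      using q by (intro sum_strict_mono) (auto simp: not_le)
    also have "\<dots> = q * (\<Sum>j<q. card (T j))" by (simp add: sum_distrib_left)
    also have "(\<Sum>j<q. card (T j)) = card (\<Union>j<q. T j)"
      using V by (intro card_UN_disjoint[symmetric]) (auto simp: T_def)
    also have "(\<Union>j<q. T j) = V" using f(1) by (auto simp: T_def)
    finally show False by simp
  qed
  then obtain j where j: "j < q" "q * card (T j) \<le> card V" by blast
  have "\<exists>i\<in>J w. L w i \<subseteq> T j" if "w \<in> \<Omega>" for w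
  proof -
    have "f \<notin> bad (w, j)" using f(2) that j(1) by blast
    then obtain i where "i \<in> J w" "\<forall>x\<in>L w i. f x = j" using f(1) unfolding bad_def by auto
    with L[OF that] show ?thesis unfolding T_def by blast
  qed
  with j show ?thesis by (intro exI[of _ "T j"]) (auto simp: T_def)
qed

section \<open>Nested traces\<close>

text \<open>The combinatorial content of the geometry: \<open>A v\<close> is the trace of
  \<open>v\<close> and \<open>\<beta> x\<close> the index of the block containing \<open>x\<close>.
  Monotonicity of \<open>\<beta>\<close> makes the blocks intervals.\<close>

locale block_graph =
  fixes V :: "'a set" and E :: "'a set set" and A :: "'a \<Rightarrow> 'b::linorder set"
    and \<beta> :: "'b \<Rightarrow> nat" and m :: nat
  assumes fin_V: "finite V"
    and A_nonempty: "v \<in> V \<Longrightarrow> A v \<noteq> {}"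
    and nonedge_iff: "u \<in> V \<Longrightarrow> v \<in> V \<Longrightarrow> u \<noteq> v \<Longrightarrow>
      {u, v} \<notin> E \<longleftrightarrow> avoids_hull (A u) (A v) \<or> avoids_hull (A v) (A u)"
    and mono_\<beta>: "mono \<beta>"
    and \<beta>_less: "\<beta> x < m"
begin

definition lo :: "'a \<Rightarrow> nat" where "lo v = Min (\<beta> ` A v)"

definition hi :: "'a \<Rightarrow> nat" where "hi v = Max (\<beta> ` A v)"

text \<open>The trace of \<open>v\<close> lies in a single gap of the trace of \<open>u\<close> or
  on one side of it. For traces lying side by side the relation holds in both directions, so in
  general it is not an order.\<close>

definition nested :: "'a \<Rightarrow> 'a \<Rightarrow> bool" where "nested v u \<longleftrightarrow> avoids_hull (A u) (A v)"

text \<open>Here \<open>u\<close> is the outer and \<open>v\<close> the inner bound, and only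
  vertices with the same first and last block as \<open>u\<close> are taken.\<close>

definition sandwich :: "'a \<Rightarrow> 'a \<Rightarrow> 'a set" where
  "sandwich u v = {w \<in> V. lo w = lo u \<and> hi w = hi u \<and> nested v w \<and> nested w u}"

definition level :: "'a \<Rightarrow> 'a \<Rightarrow> nat \<Rightarrow> 'a set" where
  "level u v i = {w \<in> sandwich u v. rank_on nested (sandwich u v) w = i}"

definition max_indep :: "'a set \<Rightarrow> bool" where
  "max_indep S \<longleftrightarrow> S \<subseteq> V \<and> indep S E \<and> (\<forall>S' \<subseteq> V. indep S' E \<longrightarrow> card S' \<le> card S)"

lemma nonedge_nested:
  "u \<in> V \<Longrightarrow> v \<in> V \<Longrightarrow> u \<noteq> v \<Longrightarrow> {u, v} \<notin> E \<longleftrightarrow> nested u v \<or> nested v u"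
  using nonedge_iff by (auto simp: nested_def)

lemma nestedD: "nested v u \<Longrightarrow> x \<in> A v \<Longrightarrow> x' \<in> A v \<Longrightarrow> y \<in> A u \<Longrightarrow> x \<le> y \<Longrightarrow> y \<le> x' \<Longrightarrow> False"
  unfolding nested_def avoids_hull_def by blast

lemma nestedI: "(\<And>x x' y. x \<in> A v \<Longrightarrow> x' \<in> A v \<Longrightarrow> y \<in> A u \<Longrightarrow> x \<le> y \<Longrightarrow> y \<le> x' \<Longrightarrow> False) \<Longrightarrow> nested v u"
  unfolding nested_def avoids_hull_def by blast

lemma nested_irrefl: "v \<in> V \<Longrightarrow> \<not> nested v v"
  using A_nonempty nestedD by (metis ex_in_conv order_refl)

lemma finite_blocks: "finite (\<beta> ` A v)"
  using \<beta>_less by (auto intro: finite_subset[of _ "{..<m}"])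

lemma lo_attained: "v \<in> V \<Longrightarrow> \<exists>p\<in>A v. \<beta> p = lo v"
  using Min_in[OF finite_blocks, of v] A_nonempty[of v] unfolding lo_def by force

lemma hi_attained: "v \<in> V \<Longrightarrow> \<exists>p\<in>A v. \<beta> p = hi v"
  using Max_in[OF finite_blocks, of v] A_nonempty[of v] unfolding hi_def by force

lemma lo_le: "x \<in> A v \<Longrightarrow> lo v \<le> \<beta> x"
  unfolding lo_def using finite_blocks by simp

lemma le_hi: "x \<in> A v \<Longrightarrow> \<beta> x \<le> hi v"
  unfolding hi_def using finite_blocks by simp

lemma lo_le_hi: "v \<in> V \<Longrightarrow> lo v \<le> hi v"
  using lo_attained le_hi by metis

lemma hi_less: "v \<in> V \<Longrightarrow> hi v < m"
  using hi_attained \<beta>_less by metis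

lemma less_if_block_less: "\<beta> x < \<beta> y \<Longrightarrow> x < y"
  using mono_\<beta> by (meson leD leI monoD)

text \<open>Since \<open>lo v < hi v\<close>, a point of \<open>u\<close> in the first block is left
  of some point of \<open>v\<close>; not lying in the hull of \<open>v\<close>, it is left of all of
  \<open>v\<close>. The last block is symmetric. Thus traces with the same two distinct end blocks
  cannot lie side by side.\<close>

lemma same_blocks_surround:
  assumes "u \<in> V" "v \<in> V" "nested v u" "lo u = lo v" "hi u = hi v" "lo v < hi v"
  obtains p p' where "p \<in> A u" "p' \<in> A u" "\<And>x. x \<in> A v \<Longrightarrow> p < x \<and> x < p'"
proof -
  obtain p where p: "p \<in> A u" "\<beta> p = lo u" using lo_attained[OF assms(1)] by blast
  obtain p' where p': "p' \<in> A u" "\<beta> p' = hi u" using hi_attained[OF assms(1)] by blast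
  obtain q where q: "q \<in> A v" "\<beta> q = lo v" using lo_attained[OF assms(2)] by blast
  obtain q' where q': "q' \<in> A v" "\<beta> q' = hi v" using hi_attained[OF assms(2)] by blast
  have lt: "p < q'" "q < p'" using p p' q q' assms by (auto intro!: less_if_block_less)
  have "p < x \<and> x < p'" if x: "x \<in> A v" for x
  proof -
    have "\<not> x \<le> p" using nestedD[OF assms(3) x q'(1) p(1)] lt by (auto dest: less_imp_le)
    moreover have "\<not> p' \<le> x" using nestedD[OF assms(3) q(1) x p'(1)] lt by (auto dest: less_imp_le)
    ultimately show ?thesis by auto
  qed
  then show ?thesis using that p p' by blast
qed

text \<open>Transitivity can fail for traces lying side by side. Equal end blocks exclude this for
  \<open>v\<close> and \<open>w\<close>: the hull of \<open>v\<close> is inside that of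
  \<open>w\<close>, which \<open>u\<close> avoids.\<close>

lemma nested_trans:
  assumes "v \<in> V" "w \<in> V" "nested v w" "nested w u"
    "lo w = lo v" "hi w = hi v" "lo v < hi v"
  shows "nested v u"
proof (rule nestedI)
  fix x x' y assume y: "x \<in> A v" "x' \<in> A v" "y \<in> A u" "x \<le> y" "y \<le> x'"
  obtain p p' where p: "p \<in> A w" "p' \<in> A w" "\<And>x. x \<in> A v \<Longrightarrow> p < x \<and> x < p'"
    using same_blocks_surround[OF assms(2,1,3,5,6,7)] by metis
  have "p \<le> y" "y \<le> p'" using p(3)[OF y(1)] p(3)[OF y(2)] y by auto
  then show False using nestedD[OF assms(4) p(1,2) y(3)] by blast
qed

text \<open>Failure of the converse puts some point of \<open>a\<close> between two points of
  \<open>b\<close>; as these avoid the hull of \<open>a\<close>, all of \<open>a\<close> stays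
  between them.\<close>

lemma enclosed:
  assumes "nested a b" "\<not> nested b a"
  obtains p p' where "p \<in> A b" "p' \<in> A b" "\<And>y. y \<in> A a \<Longrightarrow> p < y \<and> y < p'"
proof -
  obtain p p' e where e: "p \<in> A b" "p' \<in> A b" "e \<in> A a" "p \<le> e" "e \<le> p'"
    using assms(2) nestedI by metis
  have "p < y \<and> y < p'" if y: "y \<in> A a" for y
    using nestedD[OF assms(1) y e(3) e(1)] nestedD[OF assms(1) e(3) y e(2)] e by force
  then show ?thesis using that e by blast
qed

text \<open>This describes what a member of an independent set containing \<open>u\<close> and
  \<open>v\<close> looks like if it conflicts with a sandwiched \<open>w\<close>. Such an
  \<open>x\<close> is enclosed by \<open>u\<close>, and \<open>v\<close> is nested in
  \<open>x\<close>. Hence \<open>x\<close> has points only in the two end blocks: using both makes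
  it a sandwich member, otherwise it sits in one of them.\<close>

lemma blocker_cases:
  assumes V: "u \<in> V" "v \<in> V" "x \<in> V" and uv: "lo v = lo u" "hi v = hi u" "lo u < hi u"
    and xu: "x = u \<or> nested u x \<or> nested x u" and xv: "x = v \<or> nested v x \<or> nested x v"
    and w: "w \<in> sandwich u v" and xw: "\<not> nested x w" "\<not> nested w x"
  shows "x \<in> sandwich u v \<or> lo x = hi x \<and> (lo x = lo u \<or> lo x = hi u)"
proof -
  have w': "w \<in> V" "lo w = lo u" "hi w = hi u" "nested v w" "nested w u"
    using w by (auto simp: sandwich_def)
  have neq: "x \<noteq> u" "x \<noteq> v" using xw w' by auto
  \<comment> \<open>If \<open>u\<close> were nested in \<open>x\<close>, then \<open>w\<close>,
    whose hull is inside that of \<open>u\<close>, would be nested in \<open>x\<close> too.\<close>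
  have nux: "\<not> nested u x"
  proof
    assume ux: "nested u x"
    obtain p p' where p: "p \<in> A u" "p' \<in> A u" "\<And>x. x \<in> A w \<Longrightarrow> p < x \<and> x < p'"
      using same_blocks_surround[OF V(1) w'(1,5)] w' uv by metis
    have "nested w x"
    proof (rule nestedI)
      fix a a' y assume y: "a \<in> A w" "a' \<in> A w" "y \<in> A x" "a \<le> y" "y \<le> a'"
      then have "p \<le> y" "y \<le> p'" using p(3)[OF y(1)] p(3)[OF y(2)] by auto
      then show False using nestedD[OF ux p(1,2) y(3)] by blast
    qed
    with xw show False by blast
  qed
  then have xu: "nested x u" using xu neq by blast
  obtain p p' where p: "p \<in> A u" "p' \<in> A u" "\<And>y. y \<in> A x \<Longrightarrow> p < y \<and> y < p'"
    using enclosed[OF xu nux] by metis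
  have vx: "nested v x"
  proof (rule ccontr)
    assume nvx: "\<not> nested v x"
    then have "nested x v" using xv neq by blast
    then obtain q q' where q: "q \<in> A v" "q' \<in> A v" "\<And>y. y \<in> A x \<Longrightarrow> q < y \<and> y < q'"
      using enclosed[OF _ nvx] by metis
    have "nested x w"
    proof (rule nestedI)
      fix a a' y assume y: "a \<in> A x" "a' \<in> A x" "y \<in> A w" "a \<le> y" "y \<le> a'"
      then have "q \<le> y" "y \<le> q'" using q(3)[OF y(1)] q(3)[OF y(2)] by auto
      then show False using nestedD[OF w'(4) q(1,2) y(3)] by blast
    qed
    with xw show False by blast
  qed
  obtain q where q: "q \<in> A v" "\<beta> q = lo u" using lo_attained[OF V(2)] uv by metis
  obtain q' where q': "q' \<in> A v" "\<beta> q' = hi u" using hi_attained[OF V(2)] uv by metis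
  \<comment> \<open>A point of \<open>x\<close> avoids the hull of \<open>v\<close>, which reaches
    from block \<open>lo u\<close> to block \<open>hi u\<close>, but stays within the span of
    \<open>u\<close>.\<close>
  have ends: "\<beta> y = lo u \<or> \<beta> y = hi u" if y: "y \<in> A x" for y
  proof -
    have "y < q \<or> q' < y" using nestedD[OF vx q(1) q'(1) y] by force
    then have "\<beta> y \<le> lo u \<or> hi u \<le> \<beta> y" using q q' mono_\<beta> by (metis less_imp_le monoD)
    moreover have "lo u \<le> \<beta> y" "\<beta> y \<le> hi u"
      using p(3)[OF y] lo_le[OF p(1)] le_hi[OF p(2)] mono_\<beta> by (meson less_imp_le monoD order_trans)+
    ultimately show ?thesis by auto
  qed
  have "lo x = lo u \<or> lo x = hi u" "hi x = lo u \<or> hi x = hi u"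
    using ends lo_attained[OF V(3)] hi_attained[OF V(3)] by metis+
  moreover have "lo x \<le> hi x" using lo_le_hi[OF V(3)] .
  ultimately show ?thesis using uv(3) V(3) vx xu by (auto simp: sandwich_def)
qed

end

section \<open>Exchange inside a sandwich when no block contains two disjoint traces\<close>

locale sparse_block_graph = block_graph +
  assumes one_per_block: "u \<in> V \<Longrightarrow> v \<in> V \<Longrightarrow> u \<noteq> v \<Longrightarrow> {u, v} \<notin> E \<Longrightarrow>
    lo u = hi u \<Longrightarrow> lo v = hi v \<Longrightarrow> lo u \<noteq> lo v"
begin

lemma card_single_block:
  assumes "S \<subseteq> V" "indep S E"
  shows "card {x \<in> S. lo x = f \<and> hi x = f} \<le> 1"
proof -
  have "finite S" using assms(1) fin_V finite_subset by blast
  moreover have "x = y" if "x \<in> S" "lo x = f" "hi x = f" "y \<in> S" "lo y = f" "hi y = f" for x y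
    using one_per_block[of x y] that assms unfolding indep_def by auto
  ultimately show ?thesis by (auto simp: card_le_Suc0_iff_eq)
qed

lemma finite_sandwich: "finite (sandwich u v)"
  using fin_V by (auto simp: sandwich_def)

lemma indep_nested:
  "S \<subseteq> V \<Longrightarrow> indep S E \<Longrightarrow> x \<in> S \<Longrightarrow> y \<in> S \<Longrightarrow> x \<noteq> y \<Longrightarrow> nested x y \<or> nested y x"
  using nonedge_nested[of x y] unfolding indep_def by blast

text \<open>Exchange argument: take a longest chain \<open>C\<close> of the sandwich and replace by
  it the set \<open>X\<close> of all members of \<open>S\<close> that lie in \<open>C\<close> or
  conflict with it. The result is independent, so \<open>card C \<le> card X\<close>. By
  \<open>blocker_cases\<close>, \<open>X\<close> consists of sandwich members and at most one
  single-block member at each end, whence the 2.\<close>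

lemma height_sandwich_le:
  assumes S: "max_indep S" and uv: "u \<in> S" "v \<in> S" "lo v = lo u" "hi v = hi u" "lo u < hi u"
  shows "height_on nested (sandwich u v) \<le> card (S \<inter> sandwich u v) + 2"
proof -
  have SV: "S \<subseteq> V" "indep S E" and max: "\<And>S'. S' \<subseteq> V \<Longrightarrow> indep S' E \<Longrightarrow> card S' \<le> card S"
    using S by (auto simp: max_indep_def)
  have finS: "finite S" using SV fin_V finite_subset by blast
  obtain C where C: "C \<subseteq> sandwich u v" "chain_on nested C" "card C = height_on nested (sandwich u v)"
    using height_on_attained[OF finite_sandwich] by metis
  have CV: "C \<subseteq> V" using C(1) by (auto simp: sandwich_def)
  then have "finite C" using fin_V finite_subset by blast
  note CV = CV this
  define X where "X = {x \<in> S. \<exists>w\<in>C. x = w \<or> {x, w} \<in> E}"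
  have "indep ((S - X) \<union> C) E"
    unfolding indep_def
  proof (intro ballI impI)
    fix a b assume ab: "a \<in> (S - X) \<union> C" "b \<in> (S - X) \<union> C" "a \<noteq> b"
    consider "a \<in> S" "b \<in> S" | "a \<in> C" "b \<in> C" | "a \<in> S - X" "b \<in> C" | "b \<in> S - X" "a \<in> C"
      using ab by blast
    then show "{a, b} \<notin> E"
    proof cases
      case 1 then show ?thesis using SV ab unfolding indep_def by blast
    next
      case 2
      then have "a \<in> V" "b \<in> V" "nested a b \<or> nested b a" using C CV ab unfolding chain_on_def by blast+
      then show ?thesis using nonedge_nested ab(3) by blast
    next
      case 3 then show ?thesis by (auto simp: X_def)
    next
      case 4 then show ?thesis by (auto simp: X_def insert_commute)
    qed
  qed
  then have "card ((S - X) \<union> C) \<le> card S" using max SV CV by (meson Diff_subset Un_least order_trans)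
  moreover have "card ((S - X) \<union> C) = card (S - X) + card C"
    using finS CV by (intro card_Un_disjoint) (auto simp: X_def)
  moreover have "card (S - X) = card S - card X" "card X \<le> card S"
    using finS by (auto simp: X_def card_Diff_subset intro: card_mono)
  ultimately have "card C \<le> card X" by linarith
  also have "X \<subseteq> (S \<inter> sandwich u v) \<union> ({x \<in> S. lo x = lo u \<and> hi x = lo u} \<union> {x \<in> S. lo x = hi u \<and> hi x = hi u})"
  proof
    fix x assume "x \<in> X"
    then obtain w where w: "x \<in> S" "w \<in> C" "x = w \<or> {x, w} \<in> E" by (auto simp: X_def)
    show "x \<in> (S \<inter> sandwich u v) \<union> ({x \<in> S. lo x = lo u \<and> hi x = lo u} \<union> {x \<in> S. lo x = hi u \<and> hi x = hi u})"
    proof (cases "x = w")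
      case True
      then show ?thesis using w C(1) by blast
    next
      case False
      then have "\<not> nested x w" "\<not> nested w x" using nonedge_nested[of x w] w CV SV by auto
      moreover have "x = u \<or> nested u x \<or> nested x u" "x = v \<or> nested v x \<or> nested x v"
        using indep_nested[OF SV] w(1) uv(1,2) by blast+
      moreover have "u \<in> V" "v \<in> V" "x \<in> V" using uv SV w by auto
      ultimately have "x \<in> sandwich u v \<or> lo x = hi x \<and> (lo x = lo u \<or> lo x = hi u)"
        using blocker_cases[of u v x w] uv w(2) C(1) by blast
      then show ?thesis using w(1) by auto
    qed
  qed
  then have "card X \<le> card ((S \<inter> sandwich u v) \<union> ({x \<in> S. lo x = lo u \<and> hi x = lo u} \<union> {x \<in> S. lo x = hi u \<and> hi x = hi u}))"
    using finS by (intro card_mono) auto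
  also have "\<dots> \<le> card (S \<inter> sandwich u v) + (card {x \<in> S. lo x = lo u \<and> hi x = lo u} + card {x \<in> S. lo x = hi u \<and> hi x = hi u})"
    by (meson add_left_mono card_Un_le order_trans)
  also have "\<dots> \<le> card (S \<inter> sandwich u v) + 2"
    using card_single_block[OF SV, of "lo u"] card_single_block[OF SV, of "hi u"] by linarith
  finally show ?thesis using C(3) by simp
qed

lemma sandwich_order:
  assumes "lo u < hi u"
  shows "transp_on (sandwich u v) nested" "irreflp_on (sandwich u v) nested"
proof -
  show "transp_on (sandwich u v) nested"
  proof (rule transp_onI)
    fix a b c assume "a \<in> sandwich u v" "b \<in> sandwich u v" "c \<in> sandwich u v" "nested a b" "nested b c"
    then show "nested a c" using nested_trans[of a b c] assms by (auto simp: sandwich_def)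
  qed
  show "irreflp_on (sandwich u v) nested"
    using nested_irrefl by (auto simp: irreflp_on_def sandwich_def)
qed

text \<open>The sandwiched part of \<open>S\<close> is a chain, so its members have distinct ranks
  and occupy as many levels as there are members.\<close>

lemma missed_levels:
  assumes S: "max_indep S" and uv: "u \<in> S" "v \<in> S" "lo v = lo u" "hi v = hi u" "lo u < hi u"
  shows "card ({..<height_on nested (sandwich u v)} - rank_on nested (sandwich u v) ` (S \<inter> sandwich u v)) \<le> 2"
proof -
  let ?W = "sandwich u v"
  let ?r = "rank_on nested ?W"
  have SV: "S \<subseteq> V" "indep S E" using S by (auto simp: max_indep_def)
  note ord = finite_sandwich[of u v] sandwich_order[OF uv(5), of v]
  have "inj_on ?r (S \<inter> ?W)"
  proof (rule inj_onI, rule ccontr)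
    fix x y assume xy: "x \<in> S \<inter> ?W" "y \<in> S \<inter> ?W" "?r x = ?r y" "x \<noteq> y"
    then have "nested x y \<or> nested y x" using indep_nested[OF SV] by blast
    then show False using rank_on_strict_mono[OF ord, of x y] rank_on_strict_mono[OF ord, of y x] xy by auto
  qed
  then have "card (?r ` (S \<inter> ?W)) = card (S \<inter> ?W)" by (rule card_image)
  moreover have "?r ` (S \<inter> ?W) \<subseteq> {..<height_on nested ?W}"
    using rank_on_less_height_on[OF ord] by auto
  ultimately have "card ({..<height_on nested ?W} - ?r ` (S \<inter> ?W)) = height_on nested ?W - card (S \<inter> ?W)"
    using finite_sandwich by (subst card_Diff_subset) auto
  then show ?thesis using height_sandwich_le[OF assms] by linarith
qed

text \<open>On \<open>B\<close> the relation is a strict linear order; \<open>u\<close> has the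
  largest rank and \<open>v\<close> the smallest.\<close>

lemma extremes:
  assumes B: "finite B" "B \<subseteq> V" "\<And>x y. x \<in> B \<Longrightarrow> y \<in> B \<Longrightarrow> x \<noteq> y \<Longrightarrow> nested x y \<or> nested y x"
    and fg: "\<And>x. x \<in> B \<Longrightarrow> lo x = f \<and> hi x = g" "f < g" and ne: "B \<noteq> {}"
  obtains u v where "u \<in> B" "v \<in> B" "B - {u, v} \<subseteq> sandwich u v"
proof -
  have tr: "transp_on B nested"
  proof (rule transp_onI)
    fix a b c assume "a \<in> B" "b \<in> B" "c \<in> B" "nested a b" "nested b c"
    then show "nested a c" using nested_trans[of a b c] fg B(2) by auto
  qed
  have ir: "irreflp_on B nested" using B nested_irrefl by (auto simp: irreflp_on_def)
  let ?r = "rank_on nested B"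
  have sm: "x \<in> B \<Longrightarrow> y \<in> B \<Longrightarrow> nested x y \<Longrightarrow> ?r x < ?r y" for x y
    using rank_on_strict_mono[OF B(1) tr ir] by blast
  have fr: "finite (?r ` B)" "?r ` B \<noteq> {}" using B(1) ne by auto
  obtain u where u: "u \<in> B" "?r u = Max (?r ` B)" using Max_in[OF fr] by force
  obtain v where v: "v \<in> B" "?r v = Min (?r ` B)" using Min_in[OF fr] by force
  have le: "?r v \<le> ?r x" "?r x \<le> ?r u" if "x \<in> B" for x using that B(1) u(2) v(2) by auto
  have "B - {u, v} \<subseteq> sandwich u v"
  proof
    fix w assume w: "w \<in> B - {u, v}"
    then have "nested w u" using B(3)[of w u] sm[of u w] le(2)[of w] u(1) by fastforce
    moreover have "nested v w" using B(3)[of v w] sm[of w v] le(1)[of w] v(1) w by fastforce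
    ultimately show "w \<in> sandwich u v" using w B(2) fg(1) u(1) by (auto simp: sandwich_def)
  qed
  then show ?thesis using that u v by blast
qed

end

section \<open>A sparse hitting set when no block is crowded\<close>

context sparse_block_graph
begin

text \<open>Otherwise each class with \<open>f < g\<close> is either small or thin within
  \<open>V\<close>. The small ones contribute at most \<open>m^2 * K \<le> c * card V / 4\<close> in
  total, the thin ones at most \<open>c * card V / 4\<close>, and the single-block classes at most
  one each, so \<open>m \<le> c * card V / 4\<close>. Together this stays below
  \<open>c * card V\<close>.\<close>

lemma heavy_class:
  fixes c :: real
  assumes S: "S \<subseteq> V" "indep S E" and c: "c > 0" and n: "card V > 0" and big: "c * card V \<le> card S"
    and m: "real m \<le> c * card V / 4"
  obtains f g where "f < g" "c * card V / (4 * (real m)\<^sup>2) \<le> card {x \<in> S. lo x = f \<and> hi x = g}"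
    "c / 4 * card {x \<in> V. lo x = f \<and> hi x = g} \<le> card {x \<in> S. lo x = f \<and> hi x = g}"
proof (rule ccontr)
  assume nt: "\<not> thesis"
  define K where "K = c * card V / (4 * (real m)\<^sup>2)"
  let ?P = "{..<m} \<times> {..<m}"
  let ?cls = "\<lambda>S p. {x \<in> S. (lo x, hi x) = p}"
  have K0: "K \<ge> 0" using c by (simp add: K_def)
  have sum_cls: "(\<Sum>p\<in>?P. card (?cls R p)) = card R" if "R \<subseteq> V" for R
  proof -
    have "finite R" using that fin_V finite_subset by blast
    moreover have "(\<lambda>x. (lo x, hi x)) ` R \<subseteq> ?P"
      using that hi_less lo_le_hi by (auto intro: le_less_trans)
    ultimately have "(\<Sum>p\<in>?P. \<Sum>x\<in>?cls R p. 1) = (\<Sum>x\<in>R. 1::nat)"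
      by (intro sum.group) auto
    then show ?thesis by simp
  qed
  have bound: "real (card (?cls S p)) \<le> K + c / 4 * card (?cls V p) + (if fst p = snd p then 1 else 0)" for p
  proof -
    obtain f g where p: "p = (f, g)" by (cases p)
    consider "f < g" | "f = g" | "g < f" by linarith
    then show ?thesis
    proof cases
      case 1
      then have "\<not> (K \<le> card {x \<in> S. lo x = f \<and> hi x = g} \<and>
          c / 4 * card {x \<in> V. lo x = f \<and> hi x = g} \<le> card {x \<in> S. lo x = f \<and> hi x = g})"
        using that[of f g] nt unfolding K_def by blast
      then have "card (?cls S p) < K \<or> card (?cls S p) < c / 4 * card (?cls V p)"
        unfolding p prod.inject by linarith
      moreover have "c / 4 * card (?cls V p) \<ge> 0" using c by simp
      ultimately show ?thesis using K0 1 unfolding p fst_conv snd_conv by (smt (verit))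
    next
      case 2
      then have "card (?cls S p) \<le> 1" using card_single_block[OF S, of f] by (simp add: p)
      moreover have "c / 4 * card (?cls V p) \<ge> 0" using c by simp
      ultimately show ?thesis using K0 2 by (simp add: p)
    next
      case 3
      then have "?cls S p = {}" using lo_le_hi S(1) by (force simp: p)
      then have "real (card (?cls S p)) = 0" by (metis card.empty of_nat_0)
      moreover have "c / 4 * card (?cls V p) \<ge> 0" using c by simp
      ultimately show ?thesis using K0 by (auto simp: p)
    qed
  qed
  have "real (card S) = (\<Sum>p\<in>?P. real (card (?cls S p)))"
    by (subst sum_cls[OF S(1), symmetric]) (rule of_nat_sum)
  also have "\<dots> \<le> (\<Sum>p\<in>?P. K + c / 4 * card (?cls V p) + (if fst p = snd p then 1 else 0))"
    by (intro sum_mono bound)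
  also have "\<dots> = (\<Sum>p\<in>?P. K) + c / 4 * (\<Sum>p\<in>?P. real (card (?cls V p)))
      + (\<Sum>p\<in>?P. if fst p = snd p then 1 else 0)"
    by (simp add: sum.distrib sum_distrib_left)
  also have "(\<Sum>p\<in>?P. real (card (?cls V p))) = card V"
    unfolding of_nat_sum[symmetric] sum_cls[OF order_refl] ..
  also have "(\<Sum>p\<in>?P. if fst p = snd p then 1 else (0::real)) = m"
  proof -
    have "(\<Sum>p\<in>?P. if fst p = snd p then 1 else (0::real)) = (\<Sum>f<m. \<Sum>g<m. if f = g then 1 else 0)"
      unfolding sum.cartesian_product by (intro sum.cong) auto
    also have "\<dots> = m" by simp
    finally show ?thesis .
  qed
  also have "(\<Sum>p\<in>?P. K) = (real m)\<^sup>2 * K" by (simp add: card_cartesian_product power2_eq_square)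
  also have "(real m)\<^sup>2 * K \<le> c * card V / 4" using c by (simp add: K_def)
  finally have "real (card S) \<le> c * card V / 4 + c / 4 * card V + m" by simp
  also have "\<dots> < c * card V"
  proof -
    have "c * card V > 0" using c n by simp
    with m show ?thesis by linarith
  qed
  finally show False using big by simp
qed

text \<open>A transversal is built in advance for all quadruples \<open>(u, v, a, b)\<close>, at
  most \<open>card V ^ 4\<close> of them. Each maximum independent set then realises one quadruple
  and meets every level of that sandwich other than \<open>a\<close> and \<open>b\<close>, in
  particular the one contained in \<open>T\<close>.\<close>

theorem exists_sparse_hitting_set:
  fixes c :: real
  assumes c: "c > 0" and n: "card V > 0" and q: "q > 0" and m: "real m \<le> c * card V / 4"
    and M: "M \<ge> 2" "real M \<le> c * card V / (32 * (real m)\<^sup>2)" and D: "16 / c \<le> real D + 1"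
    and few: "real (card V) ^ 4 * real q * (1 - 1 / real q ^ D) ^ M < 1"
    and big: "\<And>S. max_indep S \<Longrightarrow> c * card V \<le> card S"
  shows "\<exists>T\<subseteq>V. q * card T \<le> card V \<and> (\<forall>S. max_indep S \<longrightarrow> T \<inter> S \<noteq> {})"
proof -
  let ?h = "\<lambda>u v. height_on nested (sandwich u v)"
  define J where "J u v = {i \<in> {..<?h u v}. card (level u v i) \<le> D}" for u v
  txt \<open>\<open>a\<close> and \<open>b\<close> stand for the two levels that a maximum independent set may miss.\<close>
  define \<Omega> where "\<Omega> = {(u, v, a, b). u \<in> V \<and> v \<in> V \<and> a < card V \<and> b < card V \<and> M + 2 \<le> card (J u v)}"
  have \<Omega>sub: "\<Omega> \<subseteq> V \<times> V \<times> {..<card V} \<times> {..<card V}" by (auto simp: \<Omega>_def)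
  then have fin\<Omega>: "finite \<Omega>" by (rule finite_subset) (use fin_V in auto)
  have "card \<Omega> \<le> card (V \<times> V \<times> {..<card V} \<times> {..<card V})" using \<Omega>sub fin_V by (intro card_mono) auto
  also have "\<dots> = card V ^ 4" by (simp add: card_cartesian_product power4_eq_xxxx mult.assoc)
  finally have "real (card \<Omega>) \<le> real (card V) ^ 4" by (metis of_nat_le_iff of_nat_power)
  then have few\<Omega>: "real (card \<Omega>) * real q * (1 - 1 / real q ^ D) ^ M < 1"
    using q by (intro le_less_trans[OF _ few] mult_right_mono) (auto simp: field_simps)
  \<comment> \<open>Discarding two possibly missed levels leaves at least \<open>M\<close> small
    ones.\<close>
  define J' where "J' = (\<lambda>(u, v, a, b). J u v - {a, b})"
  define L where "L = (\<lambda>(u, v, a::nat, b::nat). level u v)"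
  have "\<exists>T\<subseteq>V. q * card T \<le> card V \<and> (\<forall>w\<in>\<Omega>. \<exists>i\<in>J' w. L w i \<subseteq> T)"
  proof (rule exists_sparse_transversal[OF fin_V q fin\<Omega> _ _ few\<Omega>])
    fix w assume "w \<in> \<Omega>"
    then obtain u v a b where w: "w = (u, v, a, b)" "M + 2 \<le> card (J u v)" by (auto simp: \<Omega>_def)
    have "finite (J u v)" by (simp add: J_def)
    moreover have "card (J u v) - card {a, b} \<le> card (J u v - {a, b})" by (rule diff_card_le_card_Diff) simp
    moreover have "card {a, b} \<le> 2" by (simp add: card_insert_if)
    moreover have "disjoint_family_on (L w) (J' w)"
      by (auto simp: disjoint_family_on_def L_def w(1) level_def)
    ultimately show "finite (J' w) \<and> M \<le> card (J' w) \<and> disjoint_family_on (L w) (J' w)"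
      using w(2) by (simp add: J'_def w(1))
  next
    fix w i assume "w \<in> \<Omega>" "i \<in> J' w"
    then show "L w i \<subseteq> V \<and> card (L w i) \<le> D"
      by (auto simp: L_def J'_def J_def level_def sandwich_def split: prod.splits)
  qed
  then obtain T where T: "T \<subseteq> V" "q * card T \<le> card V" "\<And>w. w \<in> \<Omega> \<Longrightarrow> \<exists>i\<in>J' w. L w i \<subseteq> T" by blast
  have "T \<inter> S \<noteq> {}" if S: "max_indep S" for S
  proof -
    have SV: "S \<subseteq> V" "indep S E" using S by (auto simp: max_indep_def)
    have finS: "finite S" using SV fin_V finite_subset by blast
    obtain f g where fg: "f < g" "c * card V / (4 * (real m)\<^sup>2) \<le> card {x \<in> S. lo x = f \<and> hi x = g}"
      "c / 4 * card {x \<in> V. lo x = f \<and> hi x = g} \<le> card {x \<in> S. lo x = f \<and> hi x = g}"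
      by (rule heavy_class[OF SV c n big[OF S] m]) (rule that)
    define B where "B = {x \<in> S. lo x = f \<and> hi x = g}"
    \<comment> \<open>The heavy class has size at least \<open>c * card V / (4 * m^2)\<close>, eight
      times the bound on \<open>M\<close>.\<close>
    have B8: "8 * real M \<le> card B" using M(2) fg(2) by (simp add: B_def field_simps)
    have "B \<noteq> {}" using B8 M(1) by auto
    moreover have BS: "B \<subseteq> S" "finite B" using finS by (auto simp: B_def)
    moreover have "nested x y \<or> nested y x" if "x \<in> B" "y \<in> B" "x \<noteq> y" for x y
      using indep_nested[OF SV] BS(1) that by blast
    moreover have "lo x = f \<and> hi x = g" if "x \<in> B" for x using that by (simp add: B_def)
    moreover have "B \<subseteq> V" using BS(1) SV(1) by blast
    ultimately obtain u v where uv: "u \<in> B" "v \<in> B" "B - {u, v} \<subseteq> sandwich u v"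
      using extremes[of B f g] fg(1) by blast
    have uv': "u \<in> S" "v \<in> S" "lo v = lo u" "hi v = hi u" "lo u < hi u" "lo u = f" "hi u = g"
      using uv(1,2) fg(1) by (auto simp: B_def)
    let ?W = "sandwich u v" and ?H = "?h u v"
    note ord = finite_sandwich[of u v] sandwich_order[OF uv'(5), of v]
    have "chain_on nested (B - {u, v})" using indep_nested[OF SV] BS(1) by (auto simp: chain_on_def)
    then have "card (B - {u, v}) \<le> ?H" using uv(3) finite_sandwich by (intro card_le_height_on)
    moreover have "card B - card {u, v} \<le> card (B - {u, v})" by (rule diff_card_le_card_Diff) simp
    moreover have "card {u, v} \<le> 2" by (simp add: card_insert_if)
    ultimately have HB: "card B \<le> ?H + 2" by linarith
    have "?W \<subseteq> {x \<in> V. lo x = f \<and> hi x = g}" using uv' by (auto simp: sandwich_def)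
    then have "card ?W \<le> card {x \<in> V. lo x = f \<and> hi x = g}" using fin_V by (intro card_mono) auto
    then have "c / 4 * card ?W \<le> c / 4 * card {x \<in> V. lo x = f \<and> hi x = g}"
      using c by (intro mult_left_mono) auto
    then have WB: "c / 4 * card ?W \<le> card B" using fg(3) by (simp add: B_def)
    \<comment> \<open>Levels outside \<open>J u v\<close> have at least
      \<open>D + 1 \<ge> 16 / c\<close> elements each, while the sandwich has at most
      \<open>4 * card B / c\<close>; so there are at most \<open>card B / 4\<close> of them.\<close>
    have "(\<Sum>i<?H. card (level u v i)) = card ?W"
    proof -
      have "(\<Sum>i<?H. \<Sum>x\<in>{x \<in> ?W. rank_on nested ?W x = i}. 1) = (\<Sum>x\<in>?W. 1::nat)"
        using rank_on_less_height_on[OF ord] finite_sandwich by (intro sum.group) auto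
      then show ?thesis by (simp add: level_def)
    qed
    moreover have "(\<Sum>i\<in>{..<?H} - J u v. D + 1) \<le> (\<Sum>i\<in>{..<?H} - J u v. card (level u v i))"
      by (intro sum_mono) (auto simp: J_def)
    moreover have "\<dots> \<le> (\<Sum>i<?H. card (level u v i))" by (intro sum_mono2) auto
    ultimately have "card ({..<?H} - J u v) * (D + 1) \<le> card ?W" by simp
    moreover have JH: "J u v \<subseteq> {..<?H}" by (auto simp: J_def)
    moreover have "card ({..<?H} - J u v) = ?H - card (J u v)" "card (J u v) \<le> ?H"
      using card_mono[OF _ JH] card_Diff_subset[OF _ JH] finite_subset[OF JH] by auto
    ultimately have "(real ?H - card (J u v)) * (D + 1) \<le> card ?W"
      by (metis of_nat_diff of_nat_le_iff of_nat_mult)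
    moreover have "(real ?H - card (J u v)) * (16 / c) \<le> (real ?H - card (J u v)) * (D + 1)"
      using D \<open>card (J u v) \<le> ?H\<close> by (intro mult_left_mono) auto
    ultimately have "(real ?H - card (J u v)) * (16 / c) \<le> card ?W" by linarith
    then have "c / 4 * ((real ?H - card (J u v)) * (16 / c)) \<le> c / 4 * card ?W"
      using c by (intro mult_left_mono) auto
    then have "4 * (real ?H - card (J u v)) \<le> card B" using WB c by simp
    moreover have "real (card B) \<le> real ?H + 2" "real M \<ge> 2" using HB M(1) by linarith+
    \<comment> \<open>The count is \<open>card (J u v) \<ge> 3 * card B / 4 - 2 \<ge> 6 * M - 2
      \<ge> M + 2\<close>.\<close>
    ultimately have "real M + 2 \<le> real (card (J u v))" using B8 by argo
    then have J: "M + 2 \<le> card (J u v)" by linarith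
    define X where "X = {..<?H} - rank_on nested ?W ` (S \<inter> ?W)"
    have "finite X" "card X \<le> 2" using missed_levels[OF S uv'(1-5)] by (auto simp: X_def)
    have "?H \<le> card V"
    proof -
      obtain C where "C \<subseteq> ?W" "card C = ?H" using height_on_attained[OF finite_sandwich] by metis
      moreover have "?W \<subseteq> V" by (auto simp: sandwich_def)
      ultimately show ?thesis using fin_V by (metis card_mono order_trans)
    qed
    then have XV: "x < card V" if "x \<in> X" for x using that by (auto simp: X_def)
    \<comment> \<open>The at most two missed levels are encoded as a pair, padded by repetition or
      an arbitrary index when there are fewer.\<close>
    have "\<exists>a b. X \<subseteq> {a, b} \<and> a < card V \<and> b < card V"
    proof (cases "X = {}")
      case True then show ?thesis using n by blast
    next
      case False
      then obtain a where a: "a \<in> X" by blast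
      show ?thesis
      proof (cases "X = {a}")
        case True then show ?thesis using XV by blast
      next
        case False
        then obtain b where b: "b \<in> X" "b \<noteq> a" using a by blast
        have "{a, b} = X"
          using a b \<open>finite X\<close> \<open>card X \<le> 2\<close> by (intro card_seteq) (auto simp: card_insert_if)
        then show ?thesis using XV by blast
      qed
    qed
    then obtain a b where ab: "X \<subseteq> {a, b}" "a < card V" "b < card V" by blast
    have "u \<in> V" "v \<in> V" using uv'(1,2) SV(1) by auto
    then have "(u, v, a, b) \<in> \<Omega>" using ab J by (auto simp: \<Omega>_def)
    from T(3)[OF this] obtain i where i: "i \<in> J u v" "i \<notin> {a, b}" "level u v i \<subseteq> T"
      by (auto simp: J'_def L_def)
    then have "i \<notin> X" "i < ?H" using ab(1) by (auto simp: J_def)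
    then obtain x where "x \<in> S \<inter> ?W" "rank_on nested ?W x = i" unfolding X_def by blast
    then have "x \<in> T \<inter> S" using i(3) by (auto simp: level_def)
    then show ?thesis by blast
  qed
  with T(1,2) show ?thesis by blast
qed

end

section \<open>Crowded blocks and the construction of the blocks\<close>

text \<open>If \<open>S\<close> contains no vertex whose trace changes inside block
  \<open>i\<close>, each member of \<open>S\<close> meeting the block contains it entirely, hence
  contains both disjoint traces. Such members intersect pairwise, so there is at most one, and
  replacing it by \<open>a\<close> and \<open>b\<close> gives a larger independent set.\<close>

lemma (in block_graph) crowded_block_hitting:
  assumes X: "\<And>v. v \<in> V \<Longrightarrow> A v \<subseteq> X"
    and ab: "a \<in> V" "b \<in> V" "a \<noteq> b" "{a, b} \<notin> E" "lo a = i" "hi a = i" "lo b = i" "hi b = i"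
    and S: "max_indep S"
  shows "{w \<in> V. \<exists>x\<in>X. \<exists>x'\<in>X. \<beta> x = i \<and> \<beta> x' = i \<and> x \<in> A w \<and> x' \<notin> A w} \<inter> S \<noteq> {}"
proof
  assume none: "{w \<in> V. \<exists>x\<in>X. \<exists>x'\<in>X. \<beta> x = i \<and> \<beta> x' = i \<and> x \<in> A w \<and> x' \<notin> A w} \<inter> S = {}"
  have SV: "S \<subseteq> V" "indep S E" and max: "\<And>S'. S' \<subseteq> V \<Longrightarrow> indep S' E \<Longrightarrow> card S' \<le> card S"
    using S by (auto simp: max_indep_def)
  have finS: "finite S" using SV fin_V finite_subset by blast
  have blk: "\<beta> x = i" if "x \<in> A a \<union> A b" for x
    using that lo_le[of x a] lo_le[of x b] le_hi[of x a] le_hi[of x b] ab(5-8) by auto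
  have disj: "A u \<inter> A v = {}" if "u \<in> V" "v \<in> V" "u \<noteq> v" "{u, v} \<notin> E" for u v
    using nonedge_nested[of u v] that nestedD by (metis disjoint_iff order_refl)
  define Z where "Z = {x \<in> S. \<exists>y\<in>A x. \<beta> y = i}"
  have full: "A a \<union> A b \<subseteq> A w" if w: "w \<in> Z" for w
  proof
    fix y assume y: "y \<in> A a \<union> A b"
    obtain y' where y': "y' \<in> A w" "\<beta> y' = i" "w \<in> S" using w by (auto simp: Z_def)
    have "y \<in> X" "y' \<in> X" using X y y' ab(1,2) SV(1) by auto
    then show "y \<in> A w" using none y' blk[OF y] SV(1) by blast
  qed
  have ne: "A a \<noteq> {}" "A b \<noteq> {}" using A_nonempty ab by auto
  have "card Z \<le> 1"
  proof -
    have "x = y" if xy: "x \<in> Z" "y \<in> Z" for x y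
    proof (rule ccontr)
      assume "x \<noteq> y"
      then have "A x \<inter> A y = {}" using disj xy SV unfolding Z_def indep_def by blast
      then show False using full[OF xy(1)] full[OF xy(2)] ne by blast
    qed
    then show ?thesis using finS by (auto simp: card_le_Suc0_iff_eq Z_def)
  qed
  have ab_S: "a \<notin> S - Z" "b \<notin> S - Z"
    using ne blk unfolding Z_def by blast+
  \<comment> \<open>The hull of \<open>A w\<close> stays in block \<open>i\<close>, where
    \<open>x\<close> has no point.\<close>
  have apart: "{w, x} \<notin> E" if w: "w = a \<or> w = b" and x: "x \<in> S - Z" for w x
  proof -
    have "nested w x"
    proof (rule nestedI)
      fix p p' y assume h: "p \<in> A w" "p' \<in> A w" "y \<in> A x" "p \<le> y" "y \<le> p'"
      have "\<beta> p = i" "\<beta> p' = i" using blk h(1,2) w by auto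
      moreover have "\<beta> p \<le> \<beta> y" "\<beta> y \<le> \<beta> p'" using mono_\<beta> h(4,5) by (simp_all add: monoD)
      ultimately show False using x h(3) by (auto simp: Z_def)
    qed
    moreover have "w \<in> V" "x \<in> V" "w \<noteq> x" using w x ab SV(1) ab_S by auto
    ultimately show ?thesis using nonedge_nested by blast
  qed
  have "indep (insert a (insert b (S - Z))) E"
    unfolding indep_def
  proof (intro ballI impI)
    fix x y assume xy: "x \<in> insert a (insert b (S - Z))" "y \<in> insert a (insert b (S - Z))" "x \<noteq> y"
    consider "x \<in> S - Z" "y \<in> S - Z" | "{x, y} = {a, b}" | "x = a \<or> x = b" "y \<in> S - Z"
      | "y = a \<or> y = b" "x \<in> S - Z"
      using xy by blast
    then show "{x, y} \<notin> E"
    proof cases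
      case 1 then show ?thesis using SV(2) xy(3) unfolding indep_def by blast
    next
      case 2 then show ?thesis using ab(4) by simp
    next
      case 3 then show ?thesis by (rule apart)
    next
      case 4 then show ?thesis using apart[of y x] by (simp add: insert_commute)
    qed
  qed
  then have "card (insert a (insert b (S - Z))) \<le> card S"
    using max ab(1,2) SV(1) by (meson Diff_subset insert_subset order_trans)
  moreover have "card (insert a (insert b (S - Z))) = card (S - Z) + 2"
    using finS ab_S ab(3) by simp
  moreover have "card (S - Z) = card S - card Z" "card Z \<le> card S"
    using finS by (auto simp: Z_def card_Diff_subset intro: card_mono)
  ultimately show False using \<open>card Z \<le> 1\<close> by linarith
qed

text \<open>The monotone function \<open>F\<close> counts change points and is at most
  \<open>2 * K * card V\<close>; the blocks are the preimages of intervals of length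
  \<open>s\<close>. Every vertex changing inside a block makes \<open>F\<close> grow by at least 1
  there, so there are fewer than \<open>s\<close> of them.\<close>

lemma block_partition:
  fixes Y :: "'a \<Rightarrow> 'b::linorder set" and A :: "'a \<Rightarrow> 'b set"
  assumes V: "finite V" and s: "s > 0" and Y: "\<And>v. v \<in> V \<Longrightarrow> finite (Y v) \<and> card (Y v) \<le> K"
    and changes: "\<And>v x x'. v \<in> V \<Longrightarrow> x \<in> X \<Longrightarrow> x' \<in> X \<Longrightarrow> x \<le> x' \<Longrightarrow>
      (x \<in> A v) \<noteq> (x' \<in> A v) \<Longrightarrow> \<exists>y\<in>Y v. x \<le> y \<and> y \<le> x'"
  obtains \<beta> :: "'b \<Rightarrow> nat" where "mono \<beta>" "\<And>x. \<beta> x < 2 * K * card V div s + 1"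
    "\<And>i. card {w \<in> V. \<exists>x\<in>X. \<exists>x'\<in>X. \<beta> x = i \<and> \<beta> x' = i \<and> x \<in> A w \<and> x' \<notin> A w} < s"
proof -
  txt \<open>Each point of \<open>Y v\<close> counts once from its left and once from its right, so that \<open>G v\<close> grows
    across any two distinct points that have a point of \<open>Y v\<close> weakly between them.\<close>
  define G where "G v x = card {y \<in> Y v. y < x} + card {y \<in> Y v. y \<le> x}" for v x
  define F where "F x = (\<Sum>v\<in>V. G v x)" for x
  have G_mono: "G v x \<le> G v x'" if "v \<in> V" "x \<le> x'" for v x x'
    unfolding G_def using Y[OF that(1)] that(2) by (intro add_mono card_mono) auto
  have F_mono: "F x \<le> F x'" if "x \<le> x'" for x x'
    unfolding F_def using G_mono that by (intro sum_mono)
  have F_le: "F x \<le> 2 * K * card V" for x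
  proof -
    have "G v x \<le> 2 * K" if "v \<in> V" for v
    proof -
      have "card {y \<in> Y v. y < x} \<le> card (Y v)" "card {y \<in> Y v. y \<le> x} \<le> card (Y v)"
        using Y[OF that] by (auto intro: card_mono)
      then show ?thesis using Y[OF that] unfolding G_def by linarith
    qed
    then show ?thesis unfolding F_def using sum_bounded_above[of V "\<lambda>v. G v x" "2 * K"] by (simp add: mult.commute)
  qed
  have G_jump: "G v a < G v b"
    if v: "v \<in> V" and x: "x \<in> X" "x' \<in> X" "(x \<in> A v) \<noteq> (x' \<in> A v)" "x \<le> x'" "a \<le> x" "x' \<le> b" for v x x' a b
  proof -
    obtain y where y: "y \<in> Y v" "x \<le> y" "y \<le> x'" using changes[OF v x(1,2,4,3)] by blast
    have "x \<noteq> x'" using x(3) by auto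
    have fin: "finite {y \<in> Y v. y < b}" "finite {y \<in> Y v. y \<le> b}" using Y[OF v] by auto
    have le: "card {y \<in> Y v. y < a} \<le> card {y \<in> Y v. y < b}" "card {y \<in> Y v. y \<le> a} \<le> card {y \<in> Y v. y \<le> b}"
      using x fin by (auto intro!: card_mono)
    \<comment> \<open>If \<open>a < y\<close>, the count of points up to and including the argument
      gains \<open>y\<close>. Otherwise \<open>a = x = y < x'\<close>, and the count of points
      strictly below the argument gains it.\<close>
    show ?thesis
    proof (cases "a < y")
      case True
      have "card {y \<in> Y v. y \<le> a} < card {y \<in> Y v. y \<le> b}"
      proof (rule psubset_card_mono[OF fin(2)])
        have "y \<in> {y \<in> Y v. y \<le> b}" "y \<notin> {y \<in> Y v. y \<le> a}" using True y x by auto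
        moreover have "{y \<in> Y v. y \<le> a} \<subseteq> {y \<in> Y v. y \<le> b}" using x by auto
        ultimately show "{y \<in> Y v. y \<le> a} \<subset> {y \<in> Y v. y \<le> b}" by blast
      qed
      with le show ?thesis unfolding G_def by linarith
    next
      case False
      then have "y < b" using y x \<open>x \<noteq> x'\<close> by auto
      have "card {y \<in> Y v. y < a} < card {y \<in> Y v. y < b}"
      proof (rule psubset_card_mono[OF fin(1)])
        have "y \<in> {y \<in> Y v. y < b}" "y \<notin> {y \<in> Y v. y < a}" using False \<open>y < b\<close> y x(5) by auto
        moreover have "{y \<in> Y v. y < a} \<subseteq> {y \<in> Y v. y < b}" using x by auto
        ultimately show "{y \<in> Y v. y < a} \<subset> {y \<in> Y v. y < b}" by blast
      qed
      with le show ?thesis unfolding G_def by linarith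
    qed
  qed
  define \<beta> where "\<beta> x = F x div s" for x
  have "mono \<beta>" unfolding \<beta>_def by (intro monoI div_le_mono F_mono)
  moreover have "\<beta> x < 2 * K * card V div s + 1" for x
    unfolding \<beta>_def using div_le_mono[OF F_le] by (simp add: less_Suc_eq_le)
  moreover have "card {w \<in> V. \<exists>x\<in>X. \<exists>x'\<in>X. \<beta> x = i \<and> \<beta> x' = i \<and> x \<in> A w \<and> x' \<notin> A w} < s" for i
  proof -
    define T where "T = {w \<in> V. \<exists>x\<in>X. \<exists>x'\<in>X. \<beta> x = i \<and> \<beta> x' = i \<and> x \<in> A w \<and> x' \<notin> A w}"
    have TV: "T \<subseteq> V" "finite T" using V by (auto simp: T_def)
    have "card T < s"
    proof (cases "T = {}")
      case True then show ?thesis using s by simp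
    next
      case False
      have "\<forall>w\<in>T. \<exists>z. fst z \<in> X \<and> snd z \<in> X \<and> \<beta> (fst z) = i \<and> \<beta> (snd z) = i \<and> fst z \<in> A w \<and> snd z \<notin> A w"
        unfolding T_def by fastforce
      from bchoice[OF this] obtain z where z: "\<forall>w\<in>T. fst (z w) \<in> X \<and> snd (z w) \<in> X \<and>
          \<beta> (fst (z w)) = i \<and> \<beta> (snd (z w)) = i \<and> fst (z w) \<in> A w \<and> snd (z w) \<notin> A w" by blast
      define p p' where "p w = fst (z w)" and "p' w = snd (z w)" for w
      have p: "p w \<in> X \<and> p' w \<in> X \<and> \<beta> (p w) = i \<and> \<beta> (p' w) = i \<and> p w \<in> A w \<and> p' w \<notin> A w"
        if "w \<in> T" for w using z that unfolding p_def p'_def by blast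
      define Q where "Q = p ` T \<union> p' ` T"
      have Q: "finite Q" "Q \<noteq> {}" "\<And>x. x \<in> Q \<Longrightarrow> \<beta> x = i"
        using TV False p unfolding Q_def by (simp, simp, blast)
      \<comment> \<open>Extremes of all witnesses together, so that one pair \<open>a\<close>,
        \<open>b\<close> records the growth for every vertex of \<open>T\<close>.\<close>
      define a b where "a = Min Q" and "b = Max Q"
      have ab: "\<beta> a = i" "\<beta> b = i" "\<And>x. x \<in> Q \<Longrightarrow> a \<le> x \<and> x \<le> b" 
        using Q(3)[OF Min_in[OF Q(1,2)]] Q(3)[OF Max_in[OF Q(1,2)]] Q(1) by (simp_all add: a_def b_def)
      have "a \<le> b" unfolding a_def b_def using Q(1,2) by (meson Max_ge Min_in)
      have jump: "G w a + 1 \<le> G w b" if w: "w \<in> T" for w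
      proof -
        have pQ: "p w \<in> Q" "p' w \<in> Q" "w \<in> V" using w TV by (auto simp: Q_def)
        note ends = ab(3)[OF pQ(1)] ab(3)[OF pQ(2)] p[OF w]
        show ?thesis
        proof (cases "p w \<le> p' w")
          case True
          then show ?thesis using G_jump[OF pQ(3), of "p w" "p' w" a b] ends by auto
        next
          case False
          then have "p' w \<le> p w" by simp
          then show ?thesis using G_jump[OF pQ(3), of "p' w" "p w" a b] ends by auto
        qed
      qed
      have "(\<Sum>w\<in>V. if w \<in> T then 1 else 0) = (\<Sum>w\<in>T. 1::nat)"
        using sum.inter_restrict[OF V, of "\<lambda>_. 1::nat" T] unfolding Int_absorb1[OF TV(1)] by (rule sym)
      also have "\<dots> = card T" by (rule card_eq_sum[symmetric])
      finally have cT: "(\<Sum>w\<in>V. if w \<in> T then 1 else 0) = card T" .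
      have "F a + card T = (\<Sum>w\<in>V. G w a + (if w \<in> T then 1 else 0))"
        unfolding F_def sum.distrib cT ..
      also have "\<dots> \<le> F b" unfolding F_def
      proof (rule sum_mono)
        fix w assume "w \<in> V"
        then show "G w a + (if w \<in> T then 1 else 0) \<le> G w b"
          using jump[of w] G_mono[of w a b] \<open>a \<le> b\<close> by (cases "w \<in> T") simp_all
      qed
      finally have "F a + card T \<le> F b" .
      moreover have "i * s \<le> F a" using ab(1) unfolding \<beta>_def by (metis div_times_less_eq_dividend)
      moreover have "F b < i * s + s" using ab(2) s unfolding \<beta>_def by (metis add.commute dividend_less_div_times)
      ultimately show ?thesis by linarith
    qed
    then show ?thesis by (simp only: T_def)
  qed
  ultimately show ?thesis using that by blast
qed

section \<open>Bounds on the hitting number\<close>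

text \<open>The three conditions allow the factor \<open>ln (ln n)\<close>, force
  \<open>M \<ge> 2\<close>, and make the union bound work: \<open>exp\<close> of minus
  \<open>n\<close> over a power of \<open>ln n\<close> beats any polynomial.\<close>

lemma eventually_few_survivors:
  fixes \<kappa> :: real and D :: nat
  assumes "\<kappa> > 0"
  shows "eventually (\<lambda>n::nat. 1 \<le> ln (ln (real n)) \<and> 3 \<le> \<kappa> * n / (ln n)\<^sup>2 \<and>
    real n ^ 4 * ln n * exp (- (\<kappa> * n / (ln n)\<^sup>2 - 1) / ln n ^ D) < 1) sequentially"
proof (intro eventually_conj)
  show "eventually (\<lambda>n::nat. 1 \<le> ln (ln (real n))) sequentially" by real_asymp
  show "eventually (\<lambda>n::nat. 3 \<le> \<kappa> * n / (ln n)\<^sup>2) sequentially" using assms by real_asymp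
  show "eventually (\<lambda>n::nat. real n ^ 4 * ln n * exp (- (\<kappa> * n / (ln n)\<^sup>2 - 1) / ln n ^ D) < 1) sequentially"
    using assms by real_asymp
qed

lemma hitting_number_le:
  assumes "finite V" "hitting_set V E T"
  shows "hitting_number V E \<le> card T"
  unfolding hitting_number_def
proof (rule Min_le)
  have "{card T |T. hitting_set V E T} \<subseteq> card ` Pow V" by (auto simp: hitting_set_def)
  then show "finite {card T |T. hitting_set V E T}" using assms(1) finite_subset by blast
  show "card T \<in> {card T |T. hitting_set V E T}" using assms(2) by blast
qed

lemma card_indep_le_independence_number:
  assumes "finite V" "S \<subseteq> V" "indep S E"
  shows "card S \<le> independence_number V E"
  unfolding independence_number_def
proof (rule Max_ge)
  have "{card S |S. S \<subseteq> V \<and> indep S E} \<subseteq> card ` Pow V" by auto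
  then show "finite {card S |S. S \<subseteq> V \<and> indep S E}" using assms(1) finite_subset by blast
  show "card S \<in> {card S |S. S \<subseteq> V \<and> indep S E}" using assms(2,3) by blast
qed

text \<open>A crowded block gives a hitting set directly; without one the colouring argument
  applies. In \<open>m\<close> the factor 4 arises since a trace has at most \<open>2 * k\<close>
  change points, each counted twice.\<close>

lemma large_kgon_graph:
  fixes V :: "'a set" and c :: real
  assumes graph: "circle_kgon_graph k V E" and c: "c > 0" and n: "card V > 0"
    and big: "c * card V \<le> independence_number V E"
    and q: "q > 0" and m: "m = 4 * k * card V div (card V div q + 1) + 1"
    and M: "M \<ge> 2" "real M \<le> c * card V / (32 * (real m)\<^sup>2)" and D: "16 / c \<le> real D + 1"
    and few: "real (card V) ^ 4 * real q * (1 - 1 / real q ^ D) ^ M < 1"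
  shows "real (hitting_number V E) \<le> card V / q"
proof -
  obtain z r P where V: "finite V" and r: "r > 0" and P: "\<And>v. v \<in> V \<Longrightarrow> circle_kgon k z r (P v)"
    and E: "E = {{u, v} |u v. u \<in> V \<and> v \<in> V \<and> u \<noteq> v \<and> P u \<inter> P v \<noteq> {}}"
    using graph unfolding circle_kgon_graph_def by blast
  define A where "A v = angles z r (P v)" for v
  define X where "X = {0..<2 * pi}"
  have AX: "A v \<subseteq> X" for v by (auto simp: A_def X_def angles_def)
  have "\<exists>Y. finite Y \<and> card Y \<le> 2 * k \<and>
      (\<forall>x\<in>X. \<forall>x'\<in>X. x \<le> x' \<longrightarrow> (x \<in> A v) \<noteq> (x' \<in> A v) \<longrightarrow> (\<exists>y\<in>Y. x \<le> y \<and> y \<le> x'))"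
    if v: "v \<in> V" for v
  proof -
    obtain Y :: "real set" where "finite Y" "card Y \<le> 2 * k"
      "\<And>x x'. x \<in> {0..<2 * pi} \<Longrightarrow> x' \<in> {0..<2 * pi} \<Longrightarrow> x \<le> x' \<Longrightarrow>
        (x \<in> angles z r (P v)) \<noteq> (x' \<in> angles z r (P v)) \<Longrightarrow> \<exists>y\<in>Y. x \<le> y \<and> y \<le> x'"
      by (rule angles_changes[OF P[OF v] r]) (rule that)
    then show ?thesis unfolding A_def X_def by blast
  qed
  then have "\<forall>v\<in>V. \<exists>Y. finite Y \<and> card Y \<le> 2 * k \<and>
      (\<forall>x\<in>X. \<forall>x'\<in>X. x \<le> x' \<longrightarrow> (x \<in> A v) \<noteq> (x' \<in> A v) \<longrightarrow> (\<exists>y\<in>Y. x \<le> y \<and> y \<le> x'))" by blast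
  from bchoice[OF this] obtain Y where Y: "\<forall>v\<in>V. finite (Y v) \<and> card (Y v) \<le> 2 * k \<and>
      (\<forall>x\<in>X. \<forall>x'\<in>X. x \<le> x' \<longrightarrow> (x \<in> A v) \<noteq> (x' \<in> A v) \<longrightarrow> (\<exists>y\<in>Y v. x \<le> y \<and> y \<le> x'))" ..
  \<comment> \<open>Fewer than \<open>s\<close> vertices means at most \<open>card V div q\<close>,
    with no loss from rounding.\<close>
  define s where "s = card V div q + 1"
  obtain \<beta> :: "real \<Rightarrow> nat" where \<beta>: "mono \<beta>" "\<And>x. \<beta> x < 2 * (2 * k) * card V div s + 1"
    "\<And>i. card {w \<in> V. \<exists>x\<in>X. \<exists>x'\<in>X. \<beta> x = i \<and> \<beta> x' = i \<and> x \<in> A w \<and> x' \<notin> A w} < s"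
  proof (rule block_partition[of V s Y "2 * k" X A])
    show "finite V" "s > 0" using V by (auto simp: s_def)
    show "finite (Y v) \<and> card (Y v) \<le> 2 * k" if "v \<in> V" for v using Y that by blast
    show "\<exists>y\<in>Y v. x \<le> y \<and> y \<le> x'" if "v \<in> V" "x \<in> X" "x' \<in> X" "x \<le> x'" "(x \<in> A v) \<noteq> (x' \<in> A v)"
      for v x x' using Y that by blast
  qed (rule that)
  have mono\<beta>: "\<beta> x < m" for x using \<beta>(2)[of x] by (simp add: m s_def)
  interpret block_graph V E A \<beta> m
  proof
    show "finite V" by (rule V)
    show "A v \<noteq> {}" if "v \<in> V" for v using angles_nonempty[OF P[OF that] r] by (simp add: A_def)
    show "mono \<beta>" by (rule \<beta>(1))
    show "\<beta> x < m" for x by (rule mono\<beta>)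
    fix u v assume uv: "u \<in> V" "v \<in> V" "u \<noteq> v"
    have "{u, v} \<notin> E \<longleftrightarrow> P u \<inter> P v = {}"
      using uv unfolding E by (auto simp: doubleton_eq_iff Int_commute)
    also have "\<dots> \<longleftrightarrow> avoids_hull (A u) (A v) \<or> avoids_hull (A v) (A u)"
      using kgon_avoids_hull[OF P[OF uv(1)] P[OF uv(2)] r] kgon_disjointI[OF P[OF uv(1)] P[OF uv(2)] r]
        kgon_disjointI[OF P[OF uv(2)] P[OF uv(1)] r] unfolding A_def by blast
    finally show "{u, v} \<notin> E \<longleftrightarrow> avoids_hull (A u) (A v) \<or> avoids_hull (A v) (A u)" .
  qed
  have max_iff: "max_indep S" "c * card V \<le> card S" if "maximum_indep V E S" for S
    using that big card_indep_le_independence_number[OF V]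
    unfolding maximum_indep_def max_indep_def by auto
  have "\<exists>T\<subseteq>V. real (card T) \<le> card V / q \<and> (\<forall>S. maximum_indep V E S \<longrightarrow> T \<inter> S \<noteq> {})"
  proof (cases "\<exists>a\<in>V. \<exists>b\<in>V. a \<noteq> b \<and> {a, b} \<notin> E \<and> lo a = hi a \<and> lo b = hi b \<and> lo a = lo b")
    case True
    then obtain a b where ab: "a \<in> V" "b \<in> V" "a \<noteq> b" "{a, b} \<notin> E" "lo a = hi a" "lo b = hi b" "lo a = lo b"
      by blast
    let ?T = "{w \<in> V. \<exists>x\<in>X. \<exists>x'\<in>X. \<beta> x = lo a \<and> \<beta> x' = lo a \<and> x \<in> A w \<and> x' \<notin> A w}"
    have blocks: "hi a = lo a" "lo b = lo a" "hi b = lo a" using ab(5-7) by simp_all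
    have "\<forall>S. maximum_indep V E S \<longrightarrow> ?T \<inter> S \<noteq> {}"
      using crowded_block_hitting[OF AX ab(1-4) refl blocks max_iff(1)] by blast
    moreover have "card ?T \<le> card V div q" using \<beta>(3)[of "lo a"] by (simp add: s_def)
    then have "real (card ?T) \<le> card V / q"
      using order_trans[OF of_nat_mono of_nat_div_le_of_nat] by blast
    moreover have "?T \<subseteq> V" by blast
    ultimately show ?thesis by blast
  next
    case False
    interpret sparse_block_graph V E A \<beta> m
      by unfold_locales (use False in blast)
    have m0: "m \<ge> 1" by (simp add: m)
    have "2 \<le> c * card V / (32 * (real m)\<^sup>2)" using M by linarith
    then have "64 * (real m)\<^sup>2 \<le> c * card V" using m0 by (simp add: field_simps)
    moreover have "real m \<le> (real m)\<^sup>2" using m0 by (simp add: power2_eq_square)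
    ultimately have m4: "real m \<le> c * card V / 4" by linarith
    have "c * card V \<le> card S" if "max_indep S" for S
    proof -
      have "{card S |S. S \<subseteq> V \<and> indep S E} \<noteq> {}" by (auto simp: indep_def intro: exI[of _ "{}"])
      moreover have "finite {card S |S. S \<subseteq> V \<and> indep S E}"
        by (rule finite_subset[of _ "card ` Pow V"]) (use V in auto)
      ultimately have "independence_number V E \<in> {card S |S. S \<subseteq> V \<and> indep S E}"
        unfolding independence_number_def by (rule Max_in[rotated])
      then have "independence_number V E \<le> card S" using that unfolding max_indep_def by auto
      with big show ?thesis by linarith
    qed
    then obtain T where T: "T \<subseteq> V" "q * card T \<le> card V" "\<forall>S. max_indep S \<longrightarrow> T \<inter> S \<noteq> {}"
      using exists_sparse_hitting_set[OF c n q m4 M D few] by blast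
    have "real q * card T \<le> card V" using T(2) by (metis of_nat_le_iff of_nat_mult)
    then have "real (card T) \<le> card V / q" using q by (simp add: field_simps)
    with T(1,3) max_iff(1) show ?thesis by blast
  qed
  then obtain T where T: "hitting_set V E T" "real (card T) \<le> card V / q"
    unfolding hitting_set_def by blast
  have "real (hitting_number V E) \<le> real (card T)" using hitting_number_le[OF V T(1)] by simp
  with T(2) show ?thesis by linarith
qed

section \<open>Choice of parameters and the final constant\<close>

lemma kgon_graph_hitting_number:
  fixes V :: "'a set" and c :: real and k :: nat
  defines "\<kappa> \<equiv> c / (32 * (4 * real k + 1)\<^sup>2)"
  assumes graph: "circle_kgon_graph k V E" and c: "c > 0" and n: "card V = n"
    and big: "c * n \<le> independence_number V E"
    and D: "16 / c \<le> real D + 1"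
    and l1: "1 \<le> ln (ln (real n))" and l2: "3 \<le> \<kappa> * n / (ln n)\<^sup>2"
    and l3: "real n ^ 4 * ln n * exp (- (\<kappa> * n / (ln n)\<^sup>2 - 1) / ln n ^ D) < 1"
  shows "real (hitting_number V E) \<le> 2 * (n * ln (ln n) / ln n)"
proof -
  have n0: "n > 0" using l2 by (cases "n = 0") auto
  \<comment> \<open>For \<open>ln n\<close> in \<open>(0, 1)\<close> the iterated logarithm is
    negative, and for \<open>ln n = 0\<close> it is 0 by the convention
    \<open>ln 0 = 0\<close>.\<close>
  have L1: "ln n \<ge> 1"
  proof (rule ccontr)
    assume "\<not> ?thesis"
    then have "ln (real n) < 1" "0 \<le> ln (real n)" using n0 by auto
    then have "ln (ln (real n)) \<le> 0" by (cases "ln (real n) = 0") auto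
    with l1 show False by simp
  qed
  define q where "q = nat \<lfloor>ln (real n)\<rfloor>"
  have qL: "real q \<le> ln n" "ln n / 2 \<le> q" "q > 0"
  proof -
    have q: "real q = of_int \<lfloor>ln (real n)\<rfloor>" using L1 by (simp add: q_def)
    show "real q \<le> ln n" unfolding q by simp
    have "1 \<le> \<lfloor>ln (real n)\<rfloor>" using L1 by simp
    then have "real q \<ge> 1" unfolding q by linarith
    moreover have "real q \<ge> ln n - 1" unfolding q by linarith
    ultimately show "ln n / 2 \<le> q" "q > 0" by auto
  qed
  define s where "s = n div q + 1"
  define m where "m = 4 * k * n div s + 1"
  \<comment> \<open>This bounds the number of blocks by \<open>(4 * k + 1) * q\<close>, hence by a
    multiple of \<open>ln n\<close>.\<close>
  have "n < q * s" unfolding s_def using qL(3) by (metis Suc_eq_plus1 dividend_less_times_div mult_Suc_right add.commute)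
  then have "4 * k * n \<le> 4 * k * q * s" by (metis less_imp_le mult.assoc mult_le_mono2)
  then have "4 * k * n div s \<le> 4 * k * q * s div s" by (rule div_le_mono)
  also have "\<dots> = 4 * k * q" by (rule nonzero_mult_div_cancel_right) (simp add: s_def)
  finally have "4 * k * n div s \<le> 4 * k * q" .
  then have "m \<le> 4 * k * q + q" using qL(3) unfolding m_def by linarith
  then have "real m \<le> real (4 * k * q + q)" by (rule of_nat_mono)
  also have "\<dots> = (4 * real k + 1) * q" by (simp add: algebra_simps)
  also have "\<dots> \<le> (4 * real k + 1) * ln n" using qL(1) by (intro mult_left_mono) auto
  finally have "(real m)\<^sup>2 \<le> ((4 * real k + 1) * ln n)\<^sup>2" by (intro power_mono) auto
  then have "c * n / (32 * ((4 * real k + 1) * ln n)\<^sup>2) \<le> c * n / (32 * (real m)\<^sup>2)"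
    using c by (intro divide_left_mono mult_pos_pos) (auto simp: m_def)
  then have low: "\<kappa> * n / (ln n)\<^sup>2 \<le> c * n / (32 * (real m)\<^sup>2)"
    by (simp add: \<kappa>_def power_mult_distrib)
  \<comment> \<open>The largest integer permitted by the heavy class; rounding costs the 1
    subtracted in \<open>M_ge\<close>.\<close>
  define M where "M = nat \<lfloor>c * n / (32 * (real m)\<^sup>2)\<rfloor>"
  have M_le: "real M \<le> c * n / (32 * (real m)\<^sup>2)" using c by (simp add: M_def)
  have M_ge: "\<kappa> * n / (ln n)\<^sup>2 - 1 \<le> M" using low unfolding M_def by linarith
  have M2: "M \<ge> 2" using M_ge l2 by linarith
  have qD: "0 \<le> 1 - 1 / real q ^ D" using qL(3) by (simp add: field_simps)
  \<comment> \<open>This uses \<open>1 - t \<le> exp (- t)\<close>.\<close>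
  have "(1 - 1 / real q ^ D) ^ M \<le> exp (- (1 / real q ^ D)) ^ M"
    using exp_ge_add_one_self[of "- (1 / real q ^ D)"] qD by (intro power_mono) auto
  also have "\<dots> = exp (- (M / real q ^ D))" by (simp add: exp_of_nat_mult[symmetric])
  also have "\<dots> \<le> exp (- (\<kappa> * n / (ln n)\<^sup>2 - 1) / ln n ^ D)"
  proof -
    have "(\<kappa> * n / (ln n)\<^sup>2 - 1) / ln n ^ D \<le> M / real q ^ D"
      using M_ge qL L1 by (intro frac_le power_mono) auto
    then show ?thesis
      by (simp only: exp_le_cancel_iff minus_divide_left[symmetric] neg_le_iff_le)
  qed
  finally have "real n ^ 4 * real q * (1 - 1 / real q ^ D) ^ M
      \<le> real n ^ 4 * ln n * exp (- (\<kappa> * n / (ln n)\<^sup>2 - 1) / ln n ^ D)"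
    using qL(1) L1 qD by (intro mult_mono) auto
  with l3 have few: "real n ^ 4 * real q * (1 - 1 / real q ^ D) ^ M < 1" by linarith
  have "real (hitting_number V E) \<le> n / q"
    using large_kgon_graph[OF graph c _ _ qL(3), of m M D] n0 big M2 M_le D few
    by (simp add: n m_def s_def)
  also have "\<dots> \<le> n / (ln n / 2)" using qL L1 by (intro divide_left_mono) auto
  also have "\<dots> = 2 * n * 1 / ln n" by simp
  also have "\<dots> \<le> 2 * n * ln (ln n) / ln n"
    using l1 L1 mult_left_mono[of 1 "ln (ln n)" "2 * real n"] by (intro divide_right_mono) auto
  finally show ?thesis by simp
qed

lemma hitting_number_le_card:
  assumes "finite V" "independence_number V E > 0"
  shows "hitting_number V E \<le> card V"
proof (rule hitting_number_le[OF assms(1)])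
  have "V \<inter> S \<noteq> {}" if "maximum_indep V E S" for S
    using that assms unfolding maximum_indep_def by (metis Int_absorb1 card.empty less_irrefl)
  then show "hitting_set V E V" by (auto simp: hitting_set_def)
qed

text \<open>The restriction to \<open>n \<ge> 3\<close> makes \<open>ln (ln n)\<close> positive; it
  is negative for \<open>n = 2\<close>.\<close>

theorem theorem5p3:
  fixes k :: nat and c :: real
  assumes "k \<ge> 1" and "c > 0"
  shows "\<exists>C::real. \<forall>(V :: 'a set) (E :: 'a set set) (n :: nat).
           circle_kgon_graph k V E \<and> card V = n \<and> n \<ge> 3 \<and>
           real (independence_number V E) \<ge> c * real n \<longrightarrow>
           real (hitting_number V E) \<le> C * (real n * ln (ln (real n)) / ln (real n))"
proof -
  define \<kappa> where "\<kappa> = c / (32 * (4 * real k + 1)\<^sup>2)"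
  have \<kappa>: "\<kappa> > 0" using assms by (simp add: \<kappa>_def add_nonneg_pos)
  obtain D :: nat where D: "16 / c \<le> real D" using real_arch_simple by blast
  obtain N where N: "\<And>n. n \<ge> N \<Longrightarrow> 1 \<le> ln (ln (real n)) \<and> 3 \<le> \<kappa> * n / (ln n)\<^sup>2 \<and>
      real n ^ 4 * ln n * exp (- (\<kappa> * n / (ln n)\<^sup>2 - 1) / ln n ^ D) < 1"
    using eventually_few_survivors[OF \<kappa>, of D] unfolding eventually_sequentially by blast
  \<comment> \<open>The value 2 serves all \<open>n \<ge> N\<close>. Below \<open>N\<close> the
    trivial bound \<open>n\<close> is rewritten with the factor \<open>ln n / ln (ln n)\<close>,
    which is at most \<open>ln N / ln (ln 3)\<close>.\<close>
  define C where "C = max 2 (ln (real N) / ln (ln 3))"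
  have "exp 1 < (3::real)" using e_less_272 by simp
  then have "ln (exp 1) < ln (3::real)" by (subst ln_less_cancel_iff) auto
  then have ln3: "ln (3::real) > 1" by simp
  show ?thesis
  proof (intro exI[of _ C] allI impI, elim conjE)
    fix V :: "'a set" and E :: "'a set set" and n :: nat
    assume graph: "circle_kgon_graph k V E" and n: "card V = n" "n \<ge> 3"
      and big: "real (independence_number V E) \<ge> c * real n"
    have L: "ln (real n) \<ge> ln 3" using n(2) by simp
    have LL: "ln (ln (real n)) \<ge> ln (ln 3)" "ln (ln (3::real)) > 0" using L ln3 by auto
    show "real (hitting_number V E) \<le> C * (real n * ln (ln (real n)) / ln (real n))"
    proof (cases "n \<ge> N")
      case True
      have "real (hitting_number V E) \<le> 2 * (n * ln (ln n) / ln n)"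
        using kgon_graph_hitting_number[OF graph assms(2) n(1) big, of D] D N[OF True]
        unfolding \<kappa>_def by simp
      also have "\<dots> \<le> C * (n * ln (ln n) / ln n)"
        using L LL ln3 by (intro mult_right_mono divide_nonneg_pos) (auto simp: C_def)
      finally show ?thesis .
    next
      case False
      have fin: "finite V" using graph by (simp add: circle_kgon_graph_def)
      have "c * real n > 0" using assms(2) n(2) by simp
      then have "independence_number V E > 0" using big by linarith
      then have "real (hitting_number V E) \<le> n"
        using hitting_number_le_card[OF fin] n(1) by simp
      also have "\<dots> = (ln n / ln (ln n)) * (n * ln (ln n) / ln n)" using L LL ln3 by simp
      also have "\<dots> \<le> C * (n * ln (ln n) / ln n)"
      proof (rule mult_right_mono)
        have "ln n / ln (ln n) \<le> ln N / ln (ln 3)"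
          using False n(2) LL L ln3 by (intro frac_le) auto
        then show "ln n / ln (ln n) \<le> C" by (simp add: C_def)
        show "0 \<le> n * ln (ln n) / ln n" using L LL ln3 by (intro divide_nonneg_pos) auto
      qed
      finally show ?thesis .
    qed
  qed
qed

end
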